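(* Assume the law of excluded middle in the metatheory. Let $R$ be a ring in the effective topos $\mathrm{Eff}$. Then any $\neg\neg$-separated $R$-module in $\mathrm{Eff}$ embeds into a flabby $R$-module, that is, admits an $R$-linear monomorphism into an $R$-module in $\mathrm{Eff}$ whose underlying object is flabby.
   Context: The effective topos $\mathrm{Eff}$ is Hyland's realizability topos over Kleene's first algebra. A module in $\mathrm{Eff}$ is $\neg\neg$-separated if its underlying object $M$ is, that is, if $\forall x,y \in M.\ \neg\neg(x = y) \Rightarrow x = y$ holds in the internal language. An object $X$ of an elementary topos $\mathcal{E}$ is flabby if and only if the statement "for any subset $K \subseteq X$ such that $\forall x,y \in K.\ x = y$, there exists an element $x \in X$ such that $K \subseteq \{x\}$" holds in the internal language of $\mathcal{E}$. Explicitly: for any monomorphism $K \to A$ and any morphism $K \to X$ in $\mathcal{E}$, there exist an epimorphism $B \to A$ and a morphism $B \to X$ such that the composite $K \times_A B \to B \to X$ equals the composite $K \times_A B \to K \to X$. A module in $\mathcal{E}$ is flabby if its underlying object is. *)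

theory Defs
  imports Main "HOL-Library.Nat_Bijection"
begin

section \<open>Kleene's first algebra\<close>

text \<open>
  Indices for the unary partial recursive functions. Functions of several arguments are encoded
  with the Cantor pairing \<^const>\<open>prod_encode\<close>, which is surjective, so that
  \<open>CPair CFst CSnd\<close> is the identity.
\<close>

datatype code =
    CZero | CSucc | CFst | CSnd
  | CPair code code | CComp code code | CPrec code code | CMin code

abbreviation pr :: "nat \<Rightarrow> nat \<Rightarrow> nat" ("\<langle>_,/ _\<rangle>")
  where "\<langle>a, b\<rangle> \<equiv> prod_encode (a, b)"

inductive eval :: "code \<Rightarrow> nat \<Rightarrow> nat \<Rightarrow> bool" where
  zero: "eval CZero n 0"
| succ: "eval CSucc n (Suc n)"
| fst: "eval CFst \<langle>a, b\<rangle> a"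
| snd: "eval CSnd \<langle>a, b\<rangle> b"
| pair: "eval f n a \<Longrightarrow> eval g n b \<Longrightarrow> eval (CPair f g) n \<langle>a, b\<rangle>"
| comp: "eval g n a \<Longrightarrow> eval f a b \<Longrightarrow> eval (CComp f g) n b"
| prec_0: "eval f a b \<Longrightarrow> eval (CPrec f g) \<langle>a, 0\<rangle> b"
| prec_Suc: "eval (CPrec f g) \<langle>a, n\<rangle> b \<Longrightarrow> eval g \<langle>a, \<langle>n, b\<rangle>\<rangle> c \<Longrightarrow>
    eval (CPrec f g) \<langle>a, Suc n\<rangle> c"
| min: "eval f \<langle>a, k\<rangle> 0 \<Longrightarrow> (\<forall>j<k. \<exists>m. eval f \<langle>a, j\<rangle> (Suc m)) \<Longrightarrow> eval (CMin f) a k"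

text \<open>As in Kleene's indexing, numbers that are not of the form \<open>gnum c\<close> index the nowhere
  defined function.\<close>

primrec gnum :: "code \<Rightarrow> nat" where
  "gnum CZero = \<langle>0, 0\<rangle>"
| "gnum CSucc = \<langle>1, 0\<rangle>"
| "gnum CFst = \<langle>2, 0\<rangle>"
| "gnum CSnd = \<langle>3, 0\<rangle>"
| "gnum (CPair f g) = \<langle>4, \<langle>gnum f, gnum g\<rangle>\<rangle>"
| "gnum (CComp f g) = \<langle>5, \<langle>gnum f, gnum g\<rangle>\<rangle>"
| "gnum (CPrec f g) = \<langle>6, \<langle>gnum f, gnum g\<rangle>\<rangle>"
| "gnum (CMin f) = \<langle>7, gnum f\<rangle>"

text \<open>\<open>kapp e n m\<close> means that \<open>{e}(n)\<close> is defined and equal to \<open>m\<close>.\<close>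

definition kapp :: "nat \<Rightarrow> nat \<Rightarrow> nat \<Rightarrow> bool"
  where "kapp e n m \<longleftrightarrow> (\<exists>c. e = gnum c \<and> eval c n m)"

lemma gnum_inject: "gnum c = gnum d \<Longrightarrow> c = d"
proof (induction c arbitrary: d)
  case CZero then show ?case by (cases d) auto
next
  case CSucc then show ?case by (cases d) auto
next
  case CFst then show ?case by (cases d) auto
next
  case CSnd then show ?case by (cases d) auto
next
  case (CPair c1 c2) then show ?case by (cases d) auto
next
  case (CComp c1 c2) then show ?case by (cases d) auto
next
  case (CPrec c1 c2) then show ?case by (cases d) auto
next
  case (CMin c) then show ?case by (cases d) auto
qed

lemma eval_functional: "eval c n m \<Longrightarrow> eval c n m' \<Longrightarrow> m = m'"
proof (induction arbitrary: m' rule: eval.induct)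
  case (pair f n a g b)
  from pair.prems show ?case by (cases rule: eval.cases) (auto dest: pair.IH)
next
  case (comp g n a f b)
  from comp.prems show ?case by (cases rule: eval.cases) (auto dest: comp.IH)
next
  case (prec_0 f a b g)
  from prec_0.prems show ?case by (cases rule: eval.cases) (auto dest: prec_0.IH)
next
  case (prec_Suc f g a n b c)
  from prec_Suc.prems show ?case by (cases rule: eval.cases) (auto dest: prec_Suc.IH)
next
  case (min f a k)
  from min.prems show ?case
  proof (cases rule: eval.cases)
    case min
    with \<open>\<forall>j<k. _\<close> show ?thesis using min.IH(1)
      by (metis nat.distinct(1) linorder_neqE_nat \<open>\<forall>j<k. _\<close>)
  qed
qed (erule eval.cases; simp)+

lemma kapp_functional: "kapp e n m \<Longrightarrow> kapp e n m' \<Longrightarrow> m = m'"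
  by (auto simp: kapp_def dest: gnum_inject eval_functional)


section \<open>Realizability\<close>

definition rconj :: "nat set \<Rightarrow> nat set \<Rightarrow> nat set" (infixr "\<^bold>\<and>" 35)
  where "(P \<^bold>\<and> Q) = {\<langle>p, q\<rangle> | p q. p \<in> P \<and> q \<in> Q}"

definition rimp :: "nat set \<Rightarrow> nat set \<Rightarrow> nat set" (infixr "\<^bold>\<longrightarrow>" 25)
  where "(P \<^bold>\<longrightarrow> Q) = {e. \<forall>p\<in>P. \<exists>q\<in>Q. kapp e p q}"

definition riff :: "nat set \<Rightarrow> nat set \<Rightarrow> nat set" (infixr "\<^bold>\<longleftrightarrow>" 25)
  where "(P \<^bold>\<longleftrightarrow> Q) = ((P \<^bold>\<longrightarrow> Q) \<^bold>\<and> (Q \<^bold>\<longrightarrow> P))"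

definition rneg :: "nat set \<Rightarrow> nat set" ("\<^bold>\<not> _" [40] 40)
  where "(\<^bold>\<not> P) = (P \<^bold>\<longrightarrow> {})"

definition valid :: "nat set \<Rightarrow> bool"
  where "valid P \<longleftrightarrow> P \<noteq> {}"


section \<open>The effective topos\<close>

text \<open>An object is a set with a \<open>nat set\<close>-valued partial equivalence relation, symmetry and
  transitivity being realized uniformly. Values of \<open>eql\<close> off the underlying set are irrelevant,
  and likewise for the relations below.\<close>

record 'a eff_obj =
  pts :: "'a set"
  eql :: "'a \<Rightarrow> 'a \<Rightarrow> nat set"

definition eff_object :: "'a eff_obj \<Rightarrow> bool" where
  "eff_object X \<longleftrightarrow>
     valid (\<Inter>x\<in>pts X. \<Inter>y\<in>pts X. eql X x y \<^bold>\<longrightarrow> eql X y x) \<and>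
     valid (\<Inter>x\<in>pts X. \<Inter>y\<in>pts X. \<Inter>z\<in>pts X. (eql X x y \<^bold>\<and> eql X y z) \<^bold>\<longrightarrow> eql X x z)"

definition ext :: "'a eff_obj \<Rightarrow> 'a \<Rightarrow> nat set"
  where "ext X x = eql X x x"

type_synonym ('a, 'b) eff_rel = "'a \<Rightarrow> 'b \<Rightarrow> nat set"

text \<open>Morphisms are represented by functional relations. Two functional relations represent the
  same morphism iff they are related by \<open>eff_eq\<close>.\<close>

definition eff_morphism :: "'a eff_obj \<Rightarrow> 'b eff_obj \<Rightarrow> ('a, 'b) eff_rel \<Rightarrow> bool" where
  "eff_morphism X Y F \<longleftrightarrow>
     valid (\<Inter>x\<in>pts X. \<Inter>y\<in>pts Y. F x y \<^bold>\<longrightarrow> (ext X x \<^bold>\<and> ext Y y)) \<and>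
     valid (\<Inter>x\<in>pts X. \<Inter>x'\<in>pts X. \<Inter>y\<in>pts Y. \<Inter>y'\<in>pts Y.
              (F x y \<^bold>\<and> eql X x x' \<^bold>\<and> eql Y y y') \<^bold>\<longrightarrow> F x' y') \<and>
     valid (\<Inter>x\<in>pts X. \<Inter>y\<in>pts Y. \<Inter>y'\<in>pts Y. (F x y \<^bold>\<and> F x y') \<^bold>\<longrightarrow> eql Y y y') \<and>
     valid (\<Inter>x\<in>pts X. ext X x \<^bold>\<longrightarrow> (\<Union>y\<in>pts Y. F x y))"

definition eff_eq :: "'a eff_obj \<Rightarrow> 'b eff_obj \<Rightarrow> ('a, 'b) eff_rel \<Rightarrow> ('a, 'b) eff_rel \<Rightarrow> bool" where
  "eff_eq X Y F G \<longleftrightarrow> valid (\<Inter>x\<in>pts X. \<Inter>y\<in>pts Y. F x y \<^bold>\<longleftrightarrow> G x y)"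

definition eff_id :: "'a eff_obj \<Rightarrow> ('a, 'a) eff_rel"
  where "eff_id X = eql X"

text \<open>\<open>eff_comp Y G F\<close> is the composite of \<open>F : X \<rightarrow> Y\<close> followed by \<open>G : Y \<rightarrow> Z\<close>.\<close>

definition eff_comp :: "'b eff_obj \<Rightarrow> ('b, 'c) eff_rel \<Rightarrow> ('a, 'b) eff_rel \<Rightarrow> ('a, 'c) eff_rel"
  where "eff_comp Y G F x z = (\<Union>y\<in>pts Y. F x y \<^bold>\<and> G y z)"

text \<open>The type of the test objects \<open>A\<close> is fixed since a definition cannot quantify over types;
  \<open>'a \<times> 'a\<close> is large enough to hold the kernel pair of \<open>F\<close>. Hence \<open>F\<close> can then be cancelled for
  test objects \<open>A\<close> of any type, see \<open>eff_mono_cancel\<close> below.\<close>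

definition eff_mono :: "'a eff_obj \<Rightarrow> 'b eff_obj \<Rightarrow> ('a, 'b) eff_rel \<Rightarrow> bool" where
  "eff_mono X Y F \<longleftrightarrow> eff_morphism X Y F \<and>
     (\<forall>(A :: ('a \<times> 'a) eff_obj) G H. eff_object A \<longrightarrow> eff_morphism A X G \<longrightarrow> eff_morphism A X H \<longrightarrow>
        eff_eq A Y (eff_comp X F G) (eff_comp X F H) \<longrightarrow> eff_eq A X G H)"

definition eff_one :: "unit eff_obj"
  where "eff_one = \<lparr>pts = {()}, eql = (\<lambda>_ _. UNIV)\<rparr>"

definition eff_bang :: "'a eff_obj \<Rightarrow> ('a, unit) eff_rel"
  where "eff_bang X x u = ext X x"

definition eff_prod :: "'a eff_obj \<Rightarrow> 'b eff_obj \<Rightarrow> ('a \<times> 'b) eff_obj" where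
  "eff_prod X Y = \<lparr>pts = pts X \<times> pts Y,
     eql = (\<lambda>(x, y) (x', y'). eql X x x' \<^bold>\<and> eql Y y y')\<rparr>"

definition eff_fst :: "'a eff_obj \<Rightarrow> 'b eff_obj \<Rightarrow> ('a \<times> 'b, 'a) eff_rel"
  where "eff_fst X Y p x' = (eql X (fst p) x' \<^bold>\<and> ext Y (snd p))"

definition eff_snd :: "'a eff_obj \<Rightarrow> 'b eff_obj \<Rightarrow> ('a \<times> 'b, 'b) eff_rel"
  where "eff_snd X Y p y' = (ext X (fst p) \<^bold>\<and> eql Y (snd p) y')"

definition eff_pair :: "('c, 'a) eff_rel \<Rightarrow> ('c, 'b) eff_rel \<Rightarrow> ('c, 'a \<times> 'b) eff_rel"
  where "eff_pair F G c p = (F c (fst p) \<^bold>\<and> G c (snd p))"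

definition eff_power :: "'a eff_obj \<Rightarrow> ('a \<Rightarrow> nat set) eff_obj" where
  "eff_power X = \<lparr>pts = {K. \<forall>x. x \<notin> pts X \<longrightarrow> K x = {}},
     eql = (\<lambda>K L.
       (\<Inter>x\<in>pts X. K x \<^bold>\<longrightarrow> ext X x) \<^bold>\<and>
       (\<Inter>x\<in>pts X. \<Inter>x'\<in>pts X. (K x \<^bold>\<and> eql X x x') \<^bold>\<longrightarrow> K x') \<^bold>\<and>
       (\<Inter>x\<in>pts X. K x \<^bold>\<longleftrightarrow> L x))\<rparr>"


section \<open>Internal language\<close>

definition int_all :: "'a eff_obj \<Rightarrow> ('a \<Rightarrow> nat set) \<Rightarrow> nat set"
  where "int_all X \<phi> = (\<Inter>x\<in>pts X. ext X x \<^bold>\<longrightarrow> \<phi> x)"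

definition int_ex :: "'a eff_obj \<Rightarrow> ('a \<Rightarrow> nat set) \<Rightarrow> nat set"
  where "int_ex X \<phi> = (\<Union>x\<in>pts X. ext X x \<^bold>\<and> \<phi> x)"

definition int_mem :: "'a eff_obj \<Rightarrow> 'a \<Rightarrow> ('a \<Rightarrow> nat set) \<Rightarrow> nat set"
  where "int_mem X x K = (ext (eff_power X) K \<^bold>\<and> K x)"

definition notnot_separated :: "'a eff_obj \<Rightarrow> bool" where
  "notnot_separated X \<longleftrightarrow>
     valid (int_all X (\<lambda>x. int_all X (\<lambda>y. (\<^bold>\<not> \<^bold>\<not> eql X x y) \<^bold>\<longrightarrow> eql X x y)))"

definition flabby :: "'a eff_obj \<Rightarrow> bool" where
  "flabby X \<longleftrightarrow>
     valid (int_all (eff_power X) (\<lambda>K.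
       int_all X (\<lambda>x. int_all X (\<lambda>y. int_mem X x K \<^bold>\<longrightarrow> int_mem X y K \<^bold>\<longrightarrow> eql X x y)) \<^bold>\<longrightarrow>
       int_ex X (\<lambda>x. int_all X (\<lambda>y. int_mem X y K \<^bold>\<longrightarrow> eql X y x))))"


section \<open>Rings and modules in the effective topos\<close>

record 'a eff_group =
  obj :: "'a eff_obj"
  add :: "('a \<times> 'a, 'a) eff_rel"
  zero :: "(unit, 'a) eff_rel"
  neg :: "('a, 'a) eff_rel"

record 'r eff_ring = "'r eff_group" +
  mul :: "('r \<times> 'r, 'r) eff_rel"
  one :: "(unit, 'r) eff_rel"

record ('r, 'm) eff_module = "'m eff_group" +
  smul :: "('r \<times> 'm, 'm) eff_rel"

text \<open>The axioms are commutative diagrams, stated as equations between composites of the structure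
  morphisms with the projections of a product. The following operations act on generalized
  elements, that is, on morphisms with a common domain \<open>A\<close>.\<close>

definition plus_at :: "('a, 'z) eff_group_scheme \<Rightarrow> ('c, 'a) eff_rel \<Rightarrow> ('c, 'a) eff_rel \<Rightarrow> ('c, 'a) eff_rel"
  where "plus_at G f g = eff_comp (eff_prod (obj G) (obj G)) (add G) (eff_pair f g)"

definition zero_at :: "('a, 'z) eff_group_scheme \<Rightarrow> 'c eff_obj \<Rightarrow> ('c, 'a) eff_rel"
  where "zero_at G A = eff_comp eff_one (zero G) (eff_bang A)"

definition mul_at :: "('r, 'z) eff_ring_scheme \<Rightarrow> ('c, 'r) eff_rel \<Rightarrow> ('c, 'r) eff_rel \<Rightarrow> ('c, 'r) eff_rel"
  where "mul_at R f g = eff_comp (eff_prod (obj R) (obj R)) (mul R) (eff_pair f g)"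

definition one_at :: "('r, 'z) eff_ring_scheme \<Rightarrow> 'c eff_obj \<Rightarrow> ('c, 'r) eff_rel"
  where "one_at R A = eff_comp eff_one (one R) (eff_bang A)"

definition smul_at :: "('r, 'y) eff_ring_scheme \<Rightarrow> ('r, 'm, 'z) eff_module_scheme \<Rightarrow>
    ('c, 'r) eff_rel \<Rightarrow> ('c, 'm) eff_rel \<Rightarrow> ('c, 'm) eff_rel"
  where "smul_at R M f g = eff_comp (eff_prod (obj R) (obj M)) (smul M) (eff_pair f g)"

definition eff_prod3 :: "'a eff_obj \<Rightarrow> 'b eff_obj \<Rightarrow> 'c eff_obj \<Rightarrow> ('a \<times> 'b \<times> 'c) eff_obj"
  where "eff_prod3 X Y Z = eff_prod X (eff_prod Y Z)"

definition proj1 :: "'a eff_obj \<Rightarrow> 'b eff_obj \<Rightarrow> 'c eff_obj \<Rightarrow> ('a \<times> 'b \<times> 'c, 'a) eff_rel"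
  where "proj1 X Y Z = eff_fst X (eff_prod Y Z)"

definition proj2 :: "'a eff_obj \<Rightarrow> 'b eff_obj \<Rightarrow> 'c eff_obj \<Rightarrow> ('a \<times> 'b \<times> 'c, 'b) eff_rel"
  where "proj2 X Y Z = eff_comp (eff_prod Y Z) (eff_fst Y Z) (eff_snd X (eff_prod Y Z))"

definition proj3 :: "'a eff_obj \<Rightarrow> 'b eff_obj \<Rightarrow> 'c eff_obj \<Rightarrow> ('a \<times> 'b \<times> 'c, 'c) eff_rel"
  where "proj3 X Y Z = eff_comp (eff_prod Y Z) (eff_snd Y Z) (eff_snd X (eff_prod Y Z))"

definition ab_group_object :: "('a, 'z) eff_group_scheme \<Rightarrow> bool" where
  "ab_group_object G \<longleftrightarrow> (let X = obj G in
     eff_object X \<and>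
     eff_morphism (eff_prod X X) X (add G) \<and>
     eff_morphism eff_one X (zero G) \<and>
     eff_morphism X X (neg G) \<and>
     (let x = proj1 X X X; y = proj2 X X X; z = proj3 X X X in
        eff_eq (eff_prod3 X X X) X (plus_at G (plus_at G x y) z) (plus_at G x (plus_at G y z))) \<and>
     (let x = eff_fst X X; y = eff_snd X X in
        eff_eq (eff_prod X X) X (plus_at G x y) (plus_at G y x)) \<and>
     eff_eq X X (plus_at G (zero_at G X) (eff_id X)) (eff_id X) \<and>
     eff_eq X X (plus_at G (neg G) (eff_id X)) (zero_at G X))"

text \<open>Rings are unital and not assumed commutative; modules are left modules.\<close>

definition ring_object :: "('r, 'z) eff_ring_scheme \<Rightarrow> bool" where
  "ring_object R \<longleftrightarrow> (let X = obj R in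
     ab_group_object R \<and>
     eff_morphism (eff_prod X X) X (mul R) \<and>
     eff_morphism eff_one X (one R) \<and>
     (let x = proj1 X X X; y = proj2 X X X; z = proj3 X X X; P = eff_prod3 X X X in
        eff_eq P X (mul_at R (mul_at R x y) z) (mul_at R x (mul_at R y z)) \<and>
        eff_eq P X (mul_at R x (plus_at R y z)) (plus_at R (mul_at R x y) (mul_at R x z)) \<and>
        eff_eq P X (mul_at R (plus_at R x y) z) (plus_at R (mul_at R x z) (mul_at R y z))) \<and>
     eff_eq X X (mul_at R (one_at R X) (eff_id X)) (eff_id X) \<and>
     eff_eq X X (mul_at R (eff_id X) (one_at R X)) (eff_id X))"

definition module_object :: "('r, 'y) eff_ring_scheme \<Rightarrow> ('r, 'm, 'z) eff_module_scheme \<Rightarrow> bool" where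
  "module_object R M \<longleftrightarrow> (let S = obj R; X = obj M in
     ab_group_object M \<and>
     eff_morphism (eff_prod S X) X (smul M) \<and>
     (let r = proj1 S S X; s = proj2 S S X; x = proj3 S S X; P = eff_prod3 S S X in
        eff_eq P X (smul_at R M (mul_at R r s) x) (smul_at R M r (smul_at R M s x)) \<and>
        eff_eq P X (smul_at R M (plus_at R r s) x)
          (plus_at M (smul_at R M r x) (smul_at R M s x))) \<and>
     (let r = proj1 S X X; x = proj2 S X X; y = proj3 S X X in
        eff_eq (eff_prod3 S X X) X (smul_at R M r (plus_at M x y))
          (plus_at M (smul_at R M r x) (smul_at R M r y))) \<and>
     eff_eq X X (smul_at R M (one_at R X) (eff_id X)) (eff_id X))"

definition linear_morphism :: "('r, 'x) eff_ring_scheme \<Rightarrow> ('r, 'm, 'y) eff_module_scheme \<Rightarrow>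
    ('r, 'n, 'z) eff_module_scheme \<Rightarrow> ('m, 'n) eff_rel \<Rightarrow> bool" where
  "linear_morphism R M N F \<longleftrightarrow> (let S = obj R; X = obj M; Y = obj N in
     eff_morphism X Y F \<and>
     (let x = eff_fst X X; y = eff_snd X X in
        eff_eq (eff_prod X X) Y (eff_comp X F (plus_at M x y))
          (plus_at N (eff_comp X F x) (eff_comp X F y))) \<and>
     (let r = eff_fst S X; x = eff_snd S X in
        eff_eq (eff_prod S X) Y (eff_comp X F (smul_at R M r x))
          (smul_at R N r (eff_comp X F x))))"

section \<open>Cancellation of monomorphisms\<close>

definition runs :: "code \<Rightarrow> nat \<Rightarrow> nat set \<Rightarrow> bool"
  where "runs c p Q \<longleftrightarrow> (\<exists>q\<in>Q. eval c p q)"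

lemma runs_pair: "runs f p P \<Longrightarrow> runs g p Q \<Longrightarrow> runs (CPair f g) p (P \<^bold>\<and> Q)"
  by (fastforce simp: runs_def rconj_def intro: eval.pair)

lemma runs_comp: "runs c p P \<Longrightarrow> (\<And>q. q \<in> P \<Longrightarrow> runs f q Q) \<Longrightarrow> runs (CComp f c) p Q"
  by (fastforce simp: runs_def intro: eval.comp)

lemma runs_fst: "runs c p (P \<^bold>\<and> Q) \<Longrightarrow> runs (CComp CFst c) p P"
  by (erule runs_comp) (auto simp: runs_def rconj_def intro: eval.fst)

lemma runs_snd: "runs c p (P \<^bold>\<and> Q) \<Longrightarrow> runs (CComp CSnd c) p Q"
  by (erule runs_comp) (auto simp: runs_def rconj_def intro: eval.snd)

lemma runs_id: "p \<in> P \<Longrightarrow> runs (CPair CFst CSnd) p P"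
  using eval.pair[OF eval.fst eval.snd] by (metis runs_def prod.exhaust surj_prod_encode surjD)

lemma runs_UN: "y \<in> Y \<Longrightarrow> runs c p (\<chi> y) \<Longrightarrow> runs c p (\<Union>y\<in>Y. \<chi> y)"
  by (auto simp: runs_def)

lemma runs_UN_E: "runs c p (\<Union>y\<in>Y. \<chi> y) \<Longrightarrow> (\<And>y. y \<in> Y \<Longrightarrow> runs c p (\<chi> y) \<Longrightarrow> thesis) \<Longrightarrow> thesis"
  by (auto simp: runs_def)

lemma valid_imp_code:
  "valid (\<Inter>i\<in>I. P i \<^bold>\<longrightarrow> Q i) \<longleftrightarrow> (\<exists>c. \<forall>i\<in>I. \<forall>p\<in>P i. runs c p (Q i))"
proof
  assume "valid (\<Inter>i\<in>I. P i \<^bold>\<longrightarrow> Q i)"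
  then obtain e where e: "\<forall>i\<in>I. \<forall>p\<in>P i. \<exists>q\<in>Q i. kapp e p q"
    by (auto simp: valid_def rimp_def)
  show "\<exists>c. \<forall>i\<in>I. \<forall>p\<in>P i. runs c p (Q i)"
  proof (cases "\<exists>c. e = gnum c")
    case True
    with e show ?thesis by (metis gnum_inject kapp_def runs_def)
  next
    case False
    with e show ?thesis by (auto simp: kapp_def)
  qed
next
  assume "\<exists>c. \<forall>i\<in>I. \<forall>p\<in>P i. runs c p (Q i)"
  then obtain c where "\<forall>i\<in>I. \<forall>p\<in>P i. runs c p (Q i)" ..
  then have "gnum c \<in> (\<Inter>i\<in>I. P i \<^bold>\<longrightarrow> Q i)"
    by (fastforce simp: rimp_def kapp_def runs_def)
  then show "valid (\<Inter>i\<in>I. P i \<^bold>\<longrightarrow> Q i)" by (auto simp: valid_def)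
qed

lemma valid_imp_code2:
  "valid (\<Inter>x\<in>A. \<Inter>y\<in>B. P x y \<^bold>\<longrightarrow> Q x y) \<longleftrightarrow>
   (\<exists>c. \<forall>x\<in>A. \<forall>y\<in>B. \<forall>p\<in>P x y. runs c p (Q x y))"
proof -
  have "(\<Inter>x\<in>A. \<Inter>y\<in>B. P x y \<^bold>\<longrightarrow> Q x y) =
    (\<Inter>i\<in>A \<times> B. (\<lambda>(x, y). P x y) i \<^bold>\<longrightarrow> (\<lambda>(x, y). Q x y) i)"
    by auto
  then show ?thesis
    by (simp only: valid_imp_code) (rule arg_cong[where f = Ex], rule HOL.ext, auto)
qed

lemma valid_imp_code3:
  "valid (\<Inter>x\<in>A. \<Inter>y\<in>B. \<Inter>z\<in>C. P x y z \<^bold>\<longrightarrow> Q x y z) \<longleftrightarrow>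
   (\<exists>c. \<forall>x\<in>A. \<forall>y\<in>B. \<forall>z\<in>C. \<forall>p\<in>P x y z. runs c p (Q x y z))"
proof -
  have "(\<Inter>x\<in>A. \<Inter>y\<in>B. \<Inter>z\<in>C. P x y z \<^bold>\<longrightarrow> Q x y z) =
    (\<Inter>i\<in>A \<times> B \<times> C. (\<lambda>(x, y, z). P x y z) i \<^bold>\<longrightarrow> (\<lambda>(x, y, z). Q x y z) i)"
    by auto
  then show ?thesis
    by (simp only: valid_imp_code) (rule arg_cong[where f = Ex], rule HOL.ext, auto)
qed

lemma valid_imp_code4:
  "valid (\<Inter>x\<in>A. \<Inter>y\<in>B. \<Inter>z\<in>C. \<Inter>w\<in>D. P x y z w \<^bold>\<longrightarrow> Q x y z w) \<longleftrightarrow>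
   (\<exists>c. \<forall>x\<in>A. \<forall>y\<in>B. \<forall>z\<in>C. \<forall>w\<in>D. \<forall>p\<in>P x y z w. runs c p (Q x y z w))"
proof -
  have "(\<Inter>x\<in>A. \<Inter>y\<in>B. \<Inter>z\<in>C. \<Inter>w\<in>D. P x y z w \<^bold>\<longrightarrow> Q x y z w) =
    (\<Inter>i\<in>A \<times> B \<times> C \<times> D. (\<lambda>(x, y, z, w). P x y z w) i \<^bold>\<longrightarrow> (\<lambda>(x, y, z, w). Q x y z w) i)"
    by auto
  then show ?thesis
    by (simp only: valid_imp_code) (rule arg_cong[where f = Ex], rule HOL.ext, auto)
qed

lemma valid_iff_code2:
  "valid (\<Inter>x\<in>A. \<Inter>y\<in>B. P x y \<^bold>\<longleftrightarrow> Q x y) \<longleftrightarrow>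
   (\<exists>c. \<forall>x\<in>A. \<forall>y\<in>B. \<forall>p\<in>P x y. runs c p (Q x y)) \<and>
   (\<exists>c. \<forall>x\<in>A. \<forall>y\<in>B. \<forall>p\<in>Q x y. runs c p (P x y))"
proof -
  have "valid (\<Inter>x\<in>A. \<Inter>y\<in>B. P x y \<^bold>\<longleftrightarrow> Q x y) \<longleftrightarrow>
    valid (\<Inter>x\<in>A. \<Inter>y\<in>B. P x y \<^bold>\<longrightarrow> Q x y) \<and> valid (\<Inter>x\<in>A. \<Inter>y\<in>B. Q x y \<^bold>\<longrightarrow> P x y)"
    (is "?l \<longleftrightarrow> ?r")
  proof
    assume ?l
    then obtain e where e: "\<forall>x\<in>A. \<forall>y\<in>B. e \<in> (P x y \<^bold>\<longleftrightarrow> Q x y)"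
      by (auto simp: valid_def)
    obtain a b where "e = \<langle>a, b\<rangle>"
      by (metis prod.exhaust surj_prod_encode surjD)
    with e have "a \<in> (\<Inter>x\<in>A. \<Inter>y\<in>B. P x y \<^bold>\<longrightarrow> Q x y)" "b \<in> (\<Inter>x\<in>A. \<Inter>y\<in>B. Q x y \<^bold>\<longrightarrow> P x y)"
      by (auto simp: riff_def rconj_def)
    then show ?r unfolding valid_def by blast
  next
    assume ?r
    then obtain a b where "a \<in> (\<Inter>x\<in>A. \<Inter>y\<in>B. P x y \<^bold>\<longrightarrow> Q x y)"
      "b \<in> (\<Inter>x\<in>A. \<Inter>y\<in>B. Q x y \<^bold>\<longrightarrow> P x y)"
      unfolding valid_def by blast
    then have "\<langle>a, b\<rangle> \<in> (\<Inter>x\<in>A. \<Inter>y\<in>B. P x y \<^bold>\<longleftrightarrow> Q x y)"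
      by (auto simp: riff_def rconj_def)
    then show ?l unfolding valid_def by blast
  qed
  then show ?thesis by (simp add: valid_imp_code2)
qed

lemmas valid_codes = valid_imp_code valid_imp_code2 valid_imp_code3 valid_imp_code4 valid_iff_code2

lemma eff_object_sym:
  assumes "eff_object X"
  obtains s where
    "\<And>c p x y. runs c p (eql X x y) \<Longrightarrow> x \<in> pts X \<Longrightarrow> y \<in> pts X \<Longrightarrow> runs (CComp s c) p (eql X y x)"
proof -
  from assms obtain s where "\<forall>x\<in>pts X. \<forall>y\<in>pts X. \<forall>p\<in>eql X x y. runs s p (eql X y x)"
    unfolding eff_object_def valid_codes by blast
  then show ?thesis by (intro that[of s]) (rule runs_comp, assumption, blast)
qed

lemma eff_object_trans:
  assumes "eff_object X"
  obtains t where
    "\<And>c d p x y z. runs c p (eql X x y) \<Longrightarrow> runs d p (eql X y z) \<Longrightarrow>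
       x \<in> pts X \<Longrightarrow> y \<in> pts X \<Longrightarrow> z \<in> pts X \<Longrightarrow> runs (CComp t (CPair c d)) p (eql X x z)"
proof -
  from assms obtain t where
    "\<forall>x\<in>pts X. \<forall>y\<in>pts X. \<forall>z\<in>pts X. \<forall>p\<in>(eql X x y \<^bold>\<and> eql X y z). runs t p (eql X x z)"
    unfolding eff_object_def valid_codes by blast
  then show ?thesis by (intro that[of t]) (rule runs_comp, erule (1) runs_pair, blast)
qed

lemma eff_morphism_strict:
  assumes "eff_morphism X Y F"
  obtains s where
    "\<And>c p x y. runs c p (F x y) \<Longrightarrow> x \<in> pts X \<Longrightarrow> y \<in> pts Y \<Longrightarrow>
       runs (CComp s c) p (ext X x \<^bold>\<and> ext Y y)"
proof -
  from assms obtain s where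
    "\<forall>x\<in>pts X. \<forall>y\<in>pts Y. \<forall>p\<in>F x y. runs s p (ext X x \<^bold>\<and> ext Y y)"
    unfolding eff_morphism_def valid_codes by blast
  then show ?thesis by (intro that[of s]) (rule runs_comp, assumption, blast)
qed

lemma eff_morphism_rel:
  assumes "eff_morphism X Y F"
  obtains r where
    "\<And>c d f p x x' y y'. runs c p (F x y) \<Longrightarrow> runs d p (eql X x x') \<Longrightarrow> runs f p (eql Y y y') \<Longrightarrow>
       x \<in> pts X \<Longrightarrow> x' \<in> pts X \<Longrightarrow> y \<in> pts Y \<Longrightarrow> y' \<in> pts Y \<Longrightarrow>
       runs (CComp r (CPair c (CPair d f))) p (F x' y')"
proof -
  from assms obtain r where
    "\<forall>x\<in>pts X. \<forall>x'\<in>pts X. \<forall>y\<in>pts Y. \<forall>y'\<in>pts Y.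
      \<forall>p\<in>(F x y \<^bold>\<and> eql X x x' \<^bold>\<and> eql Y y y'). runs r p (F x' y')"
    unfolding eff_morphism_def valid_codes by blast
  then show ?thesis
    by (intro that[of r]) (rule runs_comp, erule runs_pair, erule (1) runs_pair, blast)
qed

lemma eff_morphism_single:
  assumes "eff_morphism X Y F"
  obtains u where
    "\<And>c d p x y y'. runs c p (F x y) \<Longrightarrow> runs d p (F x y') \<Longrightarrow>
       x \<in> pts X \<Longrightarrow> y \<in> pts Y \<Longrightarrow> y' \<in> pts Y \<Longrightarrow> runs (CComp u (CPair c d)) p (eql Y y y')"
proof -
  from assms obtain u where
    "\<forall>x\<in>pts X. \<forall>y\<in>pts Y. \<forall>y'\<in>pts Y. \<forall>p\<in>(F x y \<^bold>\<and> F x y'). runs u p (eql Y y y')"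
    unfolding eff_morphism_def valid_codes by blast
  then show ?thesis by (intro that[of u]) (rule runs_comp, erule (1) runs_pair, blast)
qed

lemma eff_morphism_total:
  assumes "eff_morphism X Y F"
  obtains t where
    "\<And>c p x. runs c p (ext X x) \<Longrightarrow> x \<in> pts X \<Longrightarrow> runs (CComp t c) p (\<Union>y\<in>pts Y. F x y)"
proof -
  from assms obtain t where "\<forall>x\<in>pts X. \<forall>p\<in>ext X x. runs t p (\<Union>y\<in>pts Y. F x y)"
    unfolding eff_morphism_def valid_codes by blast
  then show ?thesis by (intro that[of t]) (rule runs_comp, assumption, blast)
qed

lemma eff_mono_injective:
  fixes X :: "'a eff_obj" and Y :: "'b eff_obj"
  assumes X: "eff_object X" and Y: "eff_object Y" and mono: "eff_mono X Y F"
  shows "valid (\<Inter>x\<in>pts X. \<Inter>x'\<in>pts X. \<Inter>z\<in>pts Y. (F x z \<^bold>\<and> F x' z) \<^bold>\<longrightarrow> eql X x' x)"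
proof -
  from mono have F: "eff_morphism X Y F" by (simp add: eff_mono_def)
  obtain xs where
    xs: "\<And>c p x y. runs c p (eql X x y) \<Longrightarrow> x \<in> pts X \<Longrightarrow> y \<in> pts X \<Longrightarrow> runs (CComp xs c) p (eql X y x)"
    by (rule eff_object_sym[OF X]) blast
  obtain xt where
    xt: "\<And>c d p x y z. runs c p (eql X x y) \<Longrightarrow> runs d p (eql X y z) \<Longrightarrow>
       x \<in> pts X \<Longrightarrow> y \<in> pts X \<Longrightarrow> z \<in> pts X \<Longrightarrow> runs (CComp xt (CPair c d)) p (eql X x z)"
    by (rule eff_object_trans[OF X]) blast
  obtain s where
    s: "\<And>c p x y. runs c p (F x y) \<Longrightarrow> x \<in> pts X \<Longrightarrow> y \<in> pts Y \<Longrightarrow>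
       runs (CComp s c) p (ext X x \<^bold>\<and> ext Y y)"
    by (rule eff_morphism_strict[OF F]) blast
  obtain r where
    r: "\<And>c d f p x x' y y'. runs c p (F x y) \<Longrightarrow> runs d p (eql X x x') \<Longrightarrow> runs f p (eql Y y y') \<Longrightarrow>
       x \<in> pts X \<Longrightarrow> x' \<in> pts X \<Longrightarrow> y \<in> pts Y \<Longrightarrow> y' \<in> pts Y \<Longrightarrow>
       runs (CComp r (CPair c (CPair d f))) p (F x' y')"
    by (rule eff_morphism_rel[OF F]) blast
  obtain u where
    u: "\<And>c d p x y y'. runs c p (F x y) \<Longrightarrow> runs d p (F x y') \<Longrightarrow>
       x \<in> pts X \<Longrightarrow> y \<in> pts Y \<Longrightarrow> y' \<in> pts Y \<Longrightarrow> runs (CComp u (CPair c d)) p (eql Y y y')"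
    by (rule eff_morphism_single[OF F]) blast
  define ker where "ker = (\<lambda>x x'. \<Union>z\<in>pts Y. F x z \<^bold>\<and> F x' z)"
  define K :: "('a \<times> 'a) eff_obj" where
    "K = \<lparr>pts = pts X \<times> pts X,
      eql = (\<lambda>(x, x') (y, y'). (eql X x y \<^bold>\<and> eql X x' y') \<^bold>\<and> ker x x')\<rparr>"
  define G where "G = (\<lambda>(x, x') y. eql X x y \<^bold>\<and> ker x x')"
  define H where "H = (\<lambda>(x, x') y. eql X x' y \<^bold>\<and> ker x x')"
  define rF where "rF = (\<lambda>c d. CComp r (CPair c (CPair d (CComp CSnd (CComp s c)))))"
  have rF: "runs (rF c d) p (F x' y)"
    if "runs c p (F x y)" "runs d p (eql X x x')" "x \<in> pts X" "x' \<in> pts X" "y \<in> pts Y" for c d p x x' y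
    unfolding rF_def using that s[OF that(1)]
    by (intro r) (auto simp: ext_def dest: runs_snd)
  define kk where "kk = (\<lambda>c d e. CPair (rF (CComp CFst c) d) (rF (CComp CSnd c) e))"
  have kk: "runs (kk c d e) p (ker y y')"
    if "runs c p (ker x x')" "runs d p (eql X x y)" "runs e p (eql X x' y')"
      "x \<in> pts X" "x' \<in> pts X" "y \<in> pts X" "y' \<in> pts X" for c d e p x x' y y'
    using that(1) unfolding ker_def
  proof (rule runs_UN_E)
    fix z assume z: "z \<in> pts Y" "runs c p (F x z \<^bold>\<and> F x' z)"
    then show "runs (kk c d e) p (\<Union>z\<in>pts Y. F y z \<^bold>\<and> F y' z)"
      unfolding kk_def using that
      by (intro runs_UN[of z] runs_pair rF[OF runs_fst] rF[OF runs_snd])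
  qed
  have refl1: "runs (CComp xt (CPair c (CComp xs c))) p (eql X x x)"
    if "runs c p (eql X x y)" "x \<in> pts X" "y \<in> pts X" for c p x y
    using that by (blast intro: xs xt)
  have refl2: "runs (CComp xt (CPair (CComp xs c) c)) p (eql X y y)"
    if "runs c p (eql X x y)" "x \<in> pts X" "y \<in> pts X" for c p x y
    using that by (blast intro: xs xt)
  let ?I = "CPair CFst CSnd"
  let ?p = "\<lambda>c. CComp CFst c" and ?q = "\<lambda>c. CComp CSnd c"
  have K: "eff_object K"
    unfolding eff_object_def valid_codes
  proof (intro conjI exI ballI)
    fix a b p assume ab: "a \<in> pts K" "b \<in> pts K" and "p \<in> eql K a b"
    obtain x x' y y' where [simp]: "a = (x, x')" "b = (y, y')" by (cases a, cases b)
    from ab have [simp]: "x \<in> pts X" "x' \<in> pts X" "y \<in> pts X" "y' \<in> pts X" by (auto simp: K_def)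
    from \<open>p \<in> _\<close> have *: "runs ?I p ((eql X x y \<^bold>\<and> eql X x' y') \<^bold>\<and> ker x x')"
      by (intro runs_id) (simp add: K_def)
    note 1 = runs_fst[OF runs_fst[OF *]] and 2 = runs_snd[OF runs_fst[OF *]] and 3 = runs_snd[OF *]
    have "runs (CPair (CPair (CComp xs (?p (?p ?I))) (CComp xs (?q (?p ?I))))
        (kk (?q ?I) (?p (?p ?I)) (?q (?p ?I)))) p ((eql X y x \<^bold>\<and> eql X y' x') \<^bold>\<and> ker y y')"
      using 1 2 3 by (intro runs_pair xs kk[of _ _ x x']) simp_all
    then show "runs (CPair (CPair (CComp xs (?p (?p ?I))) (CComp xs (?q (?p ?I))))
        (kk (?q ?I) (?p (?p ?I)) (?q (?p ?I)))) p (eql K b a)"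
      by (simp add: K_def)
  next
    fix a b d p assume abd: "a \<in> pts K" "b \<in> pts K" "d \<in> pts K" and "p \<in> (eql K a b \<^bold>\<and> eql K b d)"
    obtain x x' y y' z z' where [simp]: "a = (x, x')" "b = (y, y')" "d = (z, z')"
      by (cases a, cases b, cases d)
    from abd have [simp]: "x \<in> pts X" "x' \<in> pts X" "y \<in> pts X" "y' \<in> pts X" "z \<in> pts X" "z' \<in> pts X"
      by (auto simp: K_def)
    from \<open>p \<in> _\<close> have *: "runs ?I p (((eql X x y \<^bold>\<and> eql X x' y') \<^bold>\<and> ker x x') \<^bold>\<and>
        ((eql X y z \<^bold>\<and> eql X y' z') \<^bold>\<and> ker y y'))"
      by (intro runs_id) (simp add: K_def)
    note a = runs_fst[OF *] and b = runs_snd[OF *]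
    note 1 = runs_fst[OF runs_fst[OF a]] runs_snd[OF runs_fst[OF a]] runs_snd[OF a]
      runs_fst[OF runs_fst[OF b]] runs_snd[OF runs_fst[OF b]]
    have "runs (CPair (CPair (CComp xt (CPair (?p (?p (?p ?I))) (?p (?p (?q ?I)))))
          (CComp xt (CPair (?q (?p (?p ?I))) (?q (?p (?q ?I)))))) (?q (?p ?I))) p
        ((eql X x z \<^bold>\<and> eql X x' z') \<^bold>\<and> ker x x')"
      using 1 by (intro runs_pair xt[of _ _ x y _ z] xt[of _ _ x' y' _ z']) simp_all
    then show "runs (CPair (CPair (CComp xt (CPair (?p (?p (?p ?I))) (?p (?p (?q ?I)))))
          (CComp xt (CPair (?q (?p (?p ?I))) (?q (?p (?q ?I)))))) (?q (?p ?I))) p (eql K a d)"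
      by (simp add: K_def)
  qed
  let ?l = "\<lambda>c. CComp xt (CPair c (CComp xs c))" and ?r = "\<lambda>c. CComp xt (CPair (CComp xs c) c)"
  have G: "eff_morphism K X G"
    unfolding eff_morphism_def valid_codes
  proof (intro conjI exI ballI)
    fix a y p assume a: "a \<in> pts K" and [simp]: "y \<in> pts X" and "p \<in> G a y"
    obtain x x' where [simp]: "a = (x, x')" by (cases a)
    from a have [simp]: "x \<in> pts X" "x' \<in> pts X" by (auto simp: K_def)
    from \<open>p \<in> _\<close> have *: "runs ?I p (eql X x y \<^bold>\<and> ker x x')"
      by (intro runs_id) (simp add: G_def)
    note 1 = runs_fst[OF *] and 2 = runs_snd[OF *]
    from 2 obtain z where [simp]: "z \<in> pts Y" and z: "runs (?q ?I) p (F x z \<^bold>\<and> F x' z)"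
      unfolding ker_def by (rule runs_UN_E)
    have 3: "runs (?p (CComp s (?q (?q ?I)))) p (eql X x' x')"
      using runs_fst[OF s[OF runs_snd[OF z]]] by (simp add: ext_def)
    have "runs (CPair (CPair (CPair (?l (?p ?I)) (?p (CComp s (?q (?q ?I))))) (?q ?I)) (?r (?p ?I))) p
        (((eql X x x \<^bold>\<and> eql X x' x') \<^bold>\<and> ker x x') \<^bold>\<and> eql X y y)"
      using 1 2 3 by (intro runs_pair refl1[of _ _ x y] refl2[of _ _ x y]) simp_all
    then show "runs (CPair (CPair (CPair (?l (?p ?I)) (?p (CComp s (?q (?q ?I))))) (?q ?I)) (?r (?p ?I))) p
        (ext K a \<^bold>\<and> ext X y)"
      by (simp add: K_def ext_def)
  next
    fix a b y y' p
    assume ab: "a \<in> pts K" "b \<in> pts K" and [simp]: "y \<in> pts X" "y' \<in> pts X"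
      and "p \<in> (G a y \<^bold>\<and> eql K a b \<^bold>\<and> eql X y y')"
    obtain x x' w w' where [simp]: "a = (x, x')" "b = (w, w')" by (cases a, cases b)
    from ab have [simp]: "x \<in> pts X" "x' \<in> pts X" "w \<in> pts X" "w' \<in> pts X" by (auto simp: K_def)
    from \<open>p \<in> _\<close> have *: "runs ?I p ((eql X x y \<^bold>\<and> ker x x') \<^bold>\<and>
        ((eql X x w \<^bold>\<and> eql X x' w') \<^bold>\<and> ker x x') \<^bold>\<and> eql X y y')"
      by (intro runs_id) (simp add: G_def K_def)
    note 1 = runs_fst[OF runs_fst[OF *]]
      and 2 = runs_fst[OF runs_fst[OF runs_fst[OF runs_snd[OF *]]]]
      and 3 = runs_snd[OF runs_fst[OF runs_fst[OF runs_snd[OF *]]]]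
      and 4 = runs_snd[OF runs_fst[OF runs_snd[OF *]]]
      and 5 = runs_snd[OF runs_snd[OF *]]
    have "runs (CPair (CComp xt (CPair (CComp xs (?p (?p (?p (?q ?I)))))
          (CComp xt (CPair (?p (?p ?I)) (?q (?q ?I))))))
        (kk (?q (?p (?q ?I))) (?p (?p (?p (?q ?I)))) (?q (?p (?p (?q ?I)))))) p
        (eql X w y' \<^bold>\<and> ker w w')"
      using 1 2 3 4 5
      by (intro runs_pair kk[of _ _ x x'] xt[of _ _ w x _ y'] xt[of _ _ x y _ y'] xs) simp_all
    then show "runs (CPair (CComp xt (CPair (CComp xs (?p (?p (?p (?q ?I)))))
          (CComp xt (CPair (?p (?p ?I)) (?q (?q ?I))))))
        (kk (?q (?p (?q ?I))) (?p (?p (?p (?q ?I)))) (?q (?p (?p (?q ?I)))))) p (G b y')"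
      by (simp add: G_def)
  next
    fix a y y' p
    assume a: "a \<in> pts K" and [simp]: "y \<in> pts X" "y' \<in> pts X" and "p \<in> (G a y \<^bold>\<and> G a y')"
    obtain x x' where [simp]: "a = (x, x')" by (cases a)
    from a have [simp]: "x \<in> pts X" "x' \<in> pts X" by (auto simp: K_def)
    from \<open>p \<in> _\<close> have *: "runs ?I p ((eql X x y \<^bold>\<and> ker x x') \<^bold>\<and> (eql X x y' \<^bold>\<and> ker x x'))"
      by (intro runs_id) (simp add: G_def)
    show "runs (CComp xt (CPair (CComp xs (?p (?p ?I))) (?p (?q ?I)))) p (eql X y y')"
      using runs_fst[OF runs_fst[OF *]] runs_fst[OF runs_snd[OF *]]
      by (intro xt[of _ _ y x _ y'] xs) simp_all
  next
    fix a p assume a: "a \<in> pts K" and "p \<in> ext K a"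
    obtain x x' where [simp]: "a = (x, x')" by (cases a)
    from a have [simp]: "x \<in> pts X" "x' \<in> pts X" by (auto simp: K_def)
    from \<open>p \<in> _\<close> have *: "runs ?I p ((eql X x x \<^bold>\<and> eql X x' x') \<^bold>\<and> ker x x')"
      by (intro runs_id) (simp add: K_def ext_def)
    have "runs (CPair (?p (?p ?I)) (?q ?I)) p (G a x)"
      unfolding G_def using runs_fst[OF runs_fst[OF *]] runs_snd[OF *] by (simp add: runs_pair)
    then show "runs (CPair (?p (?p ?I)) (?q ?I)) p (\<Union>y\<in>pts X. G a y)"
      by (intro runs_UN[of x]) simp_all
  qed
  have H: "eff_morphism K X H"
    unfolding eff_morphism_def valid_codes
  proof (intro conjI exI ballI)
    fix a y p assume a: "a \<in> pts K" and [simp]: "y \<in> pts X" and "p \<in> H a y"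
    obtain x x' where [simp]: "a = (x, x')" by (cases a)
    from a have [simp]: "x \<in> pts X" "x' \<in> pts X" by (auto simp: K_def)
    from \<open>p \<in> _\<close> have *: "runs ?I p (eql X x' y \<^bold>\<and> ker x x')"
      by (intro runs_id) (simp add: H_def)
    note 1 = runs_fst[OF *] and 2 = runs_snd[OF *]
    from 2 obtain z where [simp]: "z \<in> pts Y" and z: "runs (?q ?I) p (F x z \<^bold>\<and> F x' z)"
      unfolding ker_def by (rule runs_UN_E)
    have 3: "runs (?p (CComp s (?p (?q ?I)))) p (eql X x x)"
      using runs_fst[OF s[OF runs_fst[OF z]]] by (simp add: ext_def)
    have "runs (CPair (CPair (CPair (?p (CComp s (?p (?q ?I)))) (?l (?p ?I))) (?q ?I)) (?r (?p ?I))) p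
        (((eql X x x \<^bold>\<and> eql X x' x') \<^bold>\<and> ker x x') \<^bold>\<and> eql X y y)"
      using 1 2 3 by (intro runs_pair refl1[of _ _ x' y] refl2[of _ _ x' y]) simp_all
    then show "runs (CPair (CPair (CPair (?p (CComp s (?p (?q ?I)))) (?l (?p ?I))) (?q ?I)) (?r (?p ?I))) p
        (ext K a \<^bold>\<and> ext X y)"
      by (simp add: K_def ext_def)
  next
    fix a b y y' p
    assume ab: "a \<in> pts K" "b \<in> pts K" and [simp]: "y \<in> pts X" "y' \<in> pts X"
      and "p \<in> (H a y \<^bold>\<and> eql K a b \<^bold>\<and> eql X y y')"
    obtain x x' w w' where [simp]: "a = (x, x')" "b = (w, w')" by (cases a, cases b)
    from ab have [simp]: "x \<in> pts X" "x' \<in> pts X" "w \<in> pts X" "w' \<in> pts X" by (auto simp: K_def)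
    from \<open>p \<in> _\<close> have *: "runs ?I p ((eql X x' y \<^bold>\<and> ker x x') \<^bold>\<and>
        ((eql X x w \<^bold>\<and> eql X x' w') \<^bold>\<and> ker x x') \<^bold>\<and> eql X y y')"
      by (intro runs_id) (simp add: H_def K_def)
    note 1 = runs_fst[OF runs_fst[OF *]]
      and 2 = runs_fst[OF runs_fst[OF runs_fst[OF runs_snd[OF *]]]]
      and 3 = runs_snd[OF runs_fst[OF runs_fst[OF runs_snd[OF *]]]]
      and 4 = runs_snd[OF runs_fst[OF runs_snd[OF *]]]
      and 5 = runs_snd[OF runs_snd[OF *]]
    have "runs (CPair (CComp xt (CPair (CComp xs (?q (?p (?p (?q ?I)))))
          (CComp xt (CPair (?p (?p ?I)) (?q (?q ?I))))))
        (kk (?q (?p (?q ?I))) (?p (?p (?p (?q ?I)))) (?q (?p (?p (?q ?I)))))) p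
        (eql X w' y' \<^bold>\<and> ker w w')"
      using 1 2 3 4 5
      by (intro runs_pair kk[of _ _ x x'] xt[of _ _ w' x' _ y'] xt[of _ _ x' y _ y'] xs) simp_all
    then show "runs (CPair (CComp xt (CPair (CComp xs (?q (?p (?p (?q ?I)))))
          (CComp xt (CPair (?p (?p ?I)) (?q (?q ?I))))))
        (kk (?q (?p (?q ?I))) (?p (?p (?p (?q ?I)))) (?q (?p (?p (?q ?I)))))) p (H b y')"
      by (simp add: H_def)
  next
    fix a y y' p
    assume a: "a \<in> pts K" and [simp]: "y \<in> pts X" "y' \<in> pts X" and "p \<in> (H a y \<^bold>\<and> H a y')"
    obtain x x' where [simp]: "a = (x, x')" by (cases a)
    from a have [simp]: "x \<in> pts X" "x' \<in> pts X" by (auto simp: K_def)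
    from \<open>p \<in> _\<close> have *: "runs ?I p ((eql X x' y \<^bold>\<and> ker x x') \<^bold>\<and> (eql X x' y' \<^bold>\<and> ker x x'))"
      by (intro runs_id) (simp add: H_def)
    show "runs (CComp xt (CPair (CComp xs (?p (?p ?I))) (?p (?q ?I)))) p (eql X y y')"
      using runs_fst[OF runs_fst[OF *]] runs_fst[OF runs_snd[OF *]]
      by (intro xt[of _ _ y x' _ y'] xs) simp_all
  next
    fix a p assume a: "a \<in> pts K" and "p \<in> ext K a"
    obtain x x' where [simp]: "a = (x, x')" by (cases a)
    from a have [simp]: "x \<in> pts X" "x' \<in> pts X" by (auto simp: K_def)
    from \<open>p \<in> _\<close> have *: "runs ?I p ((eql X x x \<^bold>\<and> eql X x' x') \<^bold>\<and> ker x x')"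
      by (intro runs_id) (simp add: K_def ext_def)
    have "runs (CPair (?q (?p ?I)) (?q ?I)) p (H a x')"
      unfolding H_def using runs_snd[OF runs_fst[OF *]] runs_snd[OF *] by (simp add: runs_pair)
    then show "runs (CPair (?q (?p ?I)) (?q ?I)) p (\<Union>y\<in>pts X. H a y)"
      by (intro runs_UN[of x']) simp_all
  qed
  have "eff_eq K Y (eff_comp X F G) (eff_comp X F H)"
    unfolding eff_eq_def valid_codes
  proof (intro conjI exI ballI)
    fix a z p assume a: "a \<in> pts K" and [simp]: "z \<in> pts Y" and "p \<in> eff_comp X F G a z"
    obtain x x' where [simp]: "a = (x, x')" by (cases a)
    from a have [simp]: "x \<in> pts X" "x' \<in> pts X" by (auto simp: K_def)
    from \<open>p \<in> _\<close> obtain y where [simp]: "y \<in> pts X" and "p \<in> ((eql X x y \<^bold>\<and> ker x x') \<^bold>\<and> F y z)"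
      by (auto simp: eff_comp_def G_def)
    then have *: "runs ?I p ((eql X x y \<^bold>\<and> ker x x') \<^bold>\<and> F y z)" by (intro runs_id)
    note 1 = runs_fst[OF runs_fst[OF *]] and 2 = runs_snd[OF runs_fst[OF *]] and 3 = runs_snd[OF *]
    from 2 obtain w where [simp]: "w \<in> pts Y" and w: "runs (?q (?p ?I)) p (F x w \<^bold>\<and> F x' w)"
      unfolding ker_def by (rule runs_UN_E)
    have 4: "runs (rF (?q ?I) (CComp xs (?p (?p ?I)))) p (F x z)"
      using 1 3 by (intro rF[of _ _ y] xs) simp_all
    have 5: "runs (CComp u (CPair (?p (?q (?p ?I))) (rF (?q ?I) (CComp xs (?p (?p ?I)))))) p (eql Y w z)"
      using 4 runs_fst[OF w] by (intro u[of _ _ x]) simp_all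
    have 6: "runs (?p (CComp s (?q (?q (?p ?I))))) p (eql X x' x')"
      using runs_fst[OF s[OF runs_snd[OF w]]] by (simp add: ext_def)
    have 7: "runs (CComp r (CPair (?q (?q (?p ?I))) (CPair (?p (CComp s (?q (?q (?p ?I)))))
        (CComp u (CPair (?p (?q (?p ?I))) (rF (?q ?I) (CComp xs (?p (?p ?I))))))))) p (F x' z)"
      using 5 6 runs_snd[OF w] by (intro r[of _ _ x' w]) simp_all
    have "runs (CPair (CPair (?p (CComp s (?q (?q (?p ?I))))) (?q (?p ?I)))
        (CComp r (CPair (?q (?q (?p ?I))) (CPair (?p (CComp s (?q (?q (?p ?I)))))
        (CComp u (CPair (?p (?q (?p ?I))) (rF (?q ?I) (CComp xs (?p (?p ?I)))))))))) p
        (H a x' \<^bold>\<and> F x' z)"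
      unfolding H_def using 2 6 7 by (simp add: runs_pair)
    then show "runs (CPair (CPair (?p (CComp s (?q (?q (?p ?I))))) (?q (?p ?I)))
        (CComp r (CPair (?q (?q (?p ?I))) (CPair (?p (CComp s (?q (?q (?p ?I)))))
        (CComp u (CPair (?p (?q (?p ?I))) (rF (?q ?I) (CComp xs (?p (?p ?I)))))))))) p
        (eff_comp X F H a z)"
      unfolding eff_comp_def by (intro runs_UN[of x']) simp_all
  next
    fix a z p assume a: "a \<in> pts K" and [simp]: "z \<in> pts Y" and "p \<in> eff_comp X F H a z"
    obtain x x' where [simp]: "a = (x, x')" by (cases a)
    from a have [simp]: "x \<in> pts X" "x' \<in> pts X" by (auto simp: K_def)
    from \<open>p \<in> _\<close> obtain y where [simp]: "y \<in> pts X" and "p \<in> ((eql X x' y \<^bold>\<and> ker x x') \<^bold>\<and> F y z)"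
      by (auto simp: eff_comp_def H_def)
    then have *: "runs ?I p ((eql X x' y \<^bold>\<and> ker x x') \<^bold>\<and> F y z)" by (intro runs_id)
    note 1 = runs_fst[OF runs_fst[OF *]] and 2 = runs_snd[OF runs_fst[OF *]] and 3 = runs_snd[OF *]
    from 2 obtain w where [simp]: "w \<in> pts Y" and w: "runs (?q (?p ?I)) p (F x w \<^bold>\<and> F x' w)"
      unfolding ker_def by (rule runs_UN_E)
    have 4: "runs (rF (?q ?I) (CComp xs (?p (?p ?I)))) p (F x' z)"
      using 1 3 by (intro rF[of _ _ y] xs) simp_all
    have 5: "runs (CComp u (CPair (?q (?q (?p ?I))) (rF (?q ?I) (CComp xs (?p (?p ?I)))))) p (eql Y w z)"
      using 4 runs_snd[OF w] by (intro u[of _ _ x']) simp_all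
    have 6: "runs (?p (CComp s (?p (?q (?p ?I))))) p (eql X x x)"
      using runs_fst[OF s[OF runs_fst[OF w]]] by (simp add: ext_def)
    have 7: "runs (CComp r (CPair (?p (?q (?p ?I))) (CPair (?p (CComp s (?p (?q (?p ?I)))))
        (CComp u (CPair (?q (?q (?p ?I))) (rF (?q ?I) (CComp xs (?p (?p ?I))))))))) p (F x z)"
      using 5 6 runs_fst[OF w] by (intro r[of _ _ x w]) simp_all
    have "runs (CPair (CPair (?p (CComp s (?p (?q (?p ?I))))) (?q (?p ?I)))
        (CComp r (CPair (?p (?q (?p ?I))) (CPair (?p (CComp s (?p (?q (?p ?I)))))
        (CComp u (CPair (?q (?q (?p ?I))) (rF (?q ?I) (CComp xs (?p (?p ?I)))))))))) p
        (G a x \<^bold>\<and> F x z)"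
      unfolding G_def using 2 6 7 by (simp add: runs_pair)
    then show "runs (CPair (CPair (?p (CComp s (?p (?q (?p ?I))))) (?q (?p ?I)))
        (CComp r (CPair (?p (?q (?p ?I))) (CPair (?p (CComp s (?p (?q (?p ?I)))))
        (CComp u (CPair (?q (?q (?p ?I))) (rF (?q ?I) (CComp xs (?p (?p ?I)))))))))) p
        (eff_comp X F G a z)"
      unfolding eff_comp_def by (intro runs_UN[of x]) simp_all
  qed
  with mono K G H have "eff_eq K X G H"
    by (simp add: eff_mono_def)
  then obtain c where c: "\<forall>a\<in>pts K. \<forall>y\<in>pts X. \<forall>p\<in>G a y. runs c p (H a y)"
    unfolding eff_eq_def valid_codes by blast
  show ?thesis
    unfolding valid_codes
  proof (intro exI ballI)
    fix x x' z p
    assume [simp]: "x \<in> pts X" "x' \<in> pts X" "z \<in> pts Y" and "p \<in> (F x z \<^bold>\<and> F x' z)"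
    then have *: "runs ?I p (F x z \<^bold>\<and> F x' z)" by (intro runs_id)
    then have 1: "runs ?I p (ker x x')"
      unfolding ker_def by (intro runs_UN[of z]) simp_all
    have 2: "runs (?p (CComp s (?p ?I))) p (eql X x x)"
      using runs_fst[OF s[OF runs_fst[OF *]]] by (simp add: ext_def)
    have "runs (CPair (?p (CComp s (?p ?I))) ?I) p (G (x, x') x)"
      unfolding G_def using 1 2 by (simp add: runs_pair)
    then have "runs (CComp c (CPair (?p (CComp s (?p ?I))) ?I)) p (H (x, x') x)"
      by (rule runs_comp) (use c in \<open>simp add: K_def\<close>)
    then show "runs (?p (CComp c (CPair (?p (CComp s (?p ?I))) ?I))) p (eql X x' x)"
      unfolding H_def by (auto dest: runs_fst)
  qed
qed

lemma eff_mono_cancel: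
  fixes A :: "'t eff_obj" and X :: "'a eff_obj" and Y :: "'b eff_obj"
  assumes X: "eff_object X" and Y: "eff_object Y" and A: "eff_object A" and mono: "eff_mono X Y F"
    and G: "eff_morphism A X G" and H: "eff_morphism A X H"
    and eq: "eff_eq A Y (eff_comp X F G) (eff_comp X F H)"
  shows "eff_eq A X G H"
proof -
  have main: "\<exists>k. \<forall>a\<in>pts A. \<forall>x\<in>pts X. \<forall>p\<in>G a x. runs k p (H a x)"
    if G: "eff_morphism A X G" and H: "eff_morphism A X H"
      and eq: "\<exists>e. \<forall>a\<in>pts A. \<forall>z\<in>pts Y. \<forall>p\<in>eff_comp X F G a z. runs e p (eff_comp X F H a z)"
    for G H
  proof -
    from eff_mono_injective[OF X Y mono] obtain i where
      i: "\<forall>x\<in>pts X. \<forall>x'\<in>pts X. \<forall>z\<in>pts Y. \<forall>p\<in>(F x z \<^bold>\<and> F x' z). runs i p (eql X x' x)"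
      unfolding valid_codes by blast
    from mono have "eff_morphism X Y F" by (simp add: eff_mono_def)
    from eff_morphism_total[OF this] obtain ft where
      ft: "\<And>c p x. runs c p (ext X x) \<Longrightarrow> x \<in> pts X \<Longrightarrow> runs (CComp ft c) p (\<Union>y\<in>pts Y. F x y)"
      by blast
    from eff_morphism_strict[OF G] obtain gs where
      gs: "\<And>c p x y. runs c p (G x y) \<Longrightarrow> x \<in> pts A \<Longrightarrow> y \<in> pts X \<Longrightarrow>
         runs (CComp gs c) p (ext A x \<^bold>\<and> ext X y)"
      by blast
    from eff_morphism_rel[OF H] obtain hr where
      hr: "\<And>c d f p x x' y y'. runs c p (H x y) \<Longrightarrow> runs d p (eql A x x') \<Longrightarrow> runs f p (eql X y y') \<Longrightarrow>
         x \<in> pts A \<Longrightarrow> x' \<in> pts A \<Longrightarrow> y \<in> pts X \<Longrightarrow> y' \<in> pts X \<Longrightarrow>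
         runs (CComp hr (CPair c (CPair d f))) p (H x' y')"
      by blast
    from eq obtain e where
      e: "\<forall>a\<in>pts A. \<forall>z\<in>pts Y. \<forall>p\<in>eff_comp X F G a z. runs e p (eff_comp X F H a z)" ..
    define I where "I = CPair CFst CSnd"
    define f where "f = CComp ft (CComp CSnd (CComp gs I))"
    define h where "h = CComp e (CPair I f)"
    show ?thesis
    proof (intro exI ballI)
      fix a x p assume [simp]: "a \<in> pts A" "x \<in> pts X" and "p \<in> G a x"
      then have 1: "runs I p (G a x)" by (auto simp: I_def intro: runs_id)
      from gs[OF 1] have 2: "runs (CComp gs I) p (ext A a \<^bold>\<and> ext X x)" by simp
      from ft[OF runs_snd[OF 2]] have "runs f p (\<Union>z\<in>pts Y. F x z)" by (simp add: f_def)
      then obtain z where [simp]: "z \<in> pts Y" and z: "runs f p (F x z)" by (rule runs_UN_E)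
      have "runs (CPair I f) p (eff_comp X F G a z)"
        unfolding eff_comp_def using 1 z by (intro runs_UN[of x] runs_pair) simp_all
      then have "runs h p (eff_comp X F H a z)"
        unfolding h_def by (rule runs_comp) (use e in simp)
      then obtain x' where [simp]: "x' \<in> pts X" and x': "runs h p (H a x' \<^bold>\<and> F x' z)"
        unfolding eff_comp_def by (rule runs_UN_E)
      have "runs (CComp i (CPair f (CComp CSnd h))) p (eql X x' x)"
      proof (rule runs_comp)
        show "runs (CPair f (CComp CSnd h)) p (F x z \<^bold>\<and> F x' z)"
          using z runs_snd[OF x'] by (rule runs_pair)
      qed (use i \<open>x \<in> pts X\<close> \<open>x' \<in> pts X\<close> \<open>z \<in> pts Y\<close> in blast)
      then show "runs (CComp hr (CPair (CComp CFst h) (CPair (CComp CFst (CComp gs I))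
          (CComp i (CPair f (CComp CSnd h)))))) p (H a x)"
        using runs_fst[OF x'] runs_fst[OF 2] by (intro hr[of _ _ a x']) (simp_all add: ext_def)
    qed
  qed
  from eq have
    "\<exists>e. \<forall>a\<in>pts A. \<forall>z\<in>pts Y. \<forall>p\<in>eff_comp X F G a z. runs e p (eff_comp X F H a z)"
    "\<exists>e. \<forall>a\<in>pts A. \<forall>z\<in>pts Y. \<forall>p\<in>eff_comp X F H a z. runs e p (eff_comp X F G a z)"
    unfolding eff_eq_def valid_codes by blast+
  with main[OF G H] main[OF H G] show ?thesis
    unfolding eff_eq_def valid_codes by simp
qed

end

theory Submission
  imports Defs
begin

text \<open>
  The double negation sheafification of the underlying object \<open>X\<close> of \<open>M\<close> is again a module, it is
  flabby, and the unit \<open>X \<rightarrow> Y\<close> is monic because \<open>X\<close> is \<open>\<not>\<not>\<close>-separated. Concretely, \<open>Y\<close> has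
  the same points as \<open>X\<close>, and \<open>x = y\<close> is realized in \<open>Y\<close> by every number as soon as it is realized in
  \<open>X\<close> by some number (\<open>\<^bold>\<not> \<^bold>\<not>\<close> does precisely this to a set of realizers). So \<open>N\<close> lives on the same type
  as \<open>M\<close>.

  Why \<open>Y\<close> is flabby: by excluded middle, a subsingleton \<open>K\<close> of \<open>Y\<close> either has an inhabited point \<open>x\<close>,
  which then contains \<open>K\<close>, or it has none and \<open>x = 0\<close> does. No information about \<open>x\<close> has to be computed
  since every number realizes the existence of \<open>x\<close>; constant realizers suffice (\<open>flabby_sheafify\<close>).

  Why \<open>N\<close> is a module: call the set of pairs at which a relation has some realizer its support. Two
  morphisms into \<open>Y\<close> are equal as soon as their supports agree (\<open>eff_eq_sheafifyI\<close>). The operations of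
  \<open>N\<close> have the same supports as those of \<open>M\<close>, and supports are preserved by all the constructions
  occurring in the axioms. Hence both sides of an axiom for \<open>N\<close> have the supports of the two sides of
  the same axiom for \<open>M\<close>, which agree. Linearity of the unit follows in the same way.

  Why the unit is monic: if \<open>x\<close> and \<open>x'\<close> have the same image then \<open>\<not>\<not> x = x'\<close>, so that separatedness of
  \<open>X\<close> provides a realizer of \<open>x = x'\<close>. The realizer of separatedness is curried: applied to realizers of
  \<open>x\<close> and \<open>x'\<close> it returns numbers which have to be applied again. Monomorphisms ask for one code
  that works uniformly, so a universal partial recursive function is needed.

  Codes for composite arguments are not written down. Instead, \<open>forces r Q\<close> says that a family of
  propositions is realized uniformly in the family \<open>r\<close> of numbers, and arguments in the internal
  language become natural deduction for this relation.
\<close>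

section \<open>A universal partial recursive function\<close>

definition computable :: "(nat \<Rightarrow> nat) \<Rightarrow> bool"
  where "computable f \<longleftrightarrow> (\<exists>c. \<forall>n. eval c n (f n))"

abbreviation pfst :: "nat \<Rightarrow> nat" where "pfst n \<equiv> fst (prod_decode n)"
abbreviation psnd :: "nat \<Rightarrow> nat" where "psnd n \<equiv> snd (prod_decode n)"

lemma eval_CFst: "eval CFst n (pfst n)"
  by (metis eval.fst prod.collapse prod_decode_inverse)

lemma eval_CSnd: "eval CSnd n (psnd n)"
  by (metis eval.snd prod.collapse prod_decode_inverse)

lemma computable_id: "computable (\<lambda>n. n)"
  unfolding computable_def
  by (intro exI[of _ "CPair CFst CSnd"])
    (metis eval.pair eval_CFst eval_CSnd prod.collapse prod_decode_inverse)

lemma computable_comp: "computable g \<Longrightarrow> computable f \<Longrightarrow> computable (\<lambda>n. g (f n))"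
  unfolding computable_def by (blast intro: eval.comp)

lemma computable_pair: "computable f \<Longrightarrow> computable g \<Longrightarrow> computable (\<lambda>n. \<langle>f n, g n\<rangle>)"
  unfolding computable_def by (blast intro: eval.pair)

lemma computable_Suc: "computable f \<Longrightarrow> computable (\<lambda>n. Suc (f n))"
  by (rule computable_comp[of Suc]) (auto simp: computable_def intro: eval.succ)

lemma computable_fst: "computable f \<Longrightarrow> computable (\<lambda>n. pfst (f n))"
  by (rule computable_comp[of pfst]) (auto simp: computable_def intro: eval_CFst)

lemma computable_snd: "computable f \<Longrightarrow> computable (\<lambda>n. psnd (f n))"
  by (rule computable_comp[of psnd]) (auto simp: computable_def intro: eval_CSnd)

lemma computable_const: "computable (\<lambda>_. k)"
proof (induction k)
  case 0
  show ?case by (auto simp: computable_def intro: eval.zero)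
next
  case (Suc k)
  then show ?case by (rule computable_Suc)
qed

text \<open>
  A single primitive recursion over total functions; predecessor and case distinction are the
  instances that ignore the recursive value.
\<close>

lemma computable_rec:
  assumes "computable f" "computable g"
  shows "computable (\<lambda>p. rec_nat (f (pfst p)) (\<lambda>n b. g \<langle>pfst p, \<langle>n, b\<rangle>\<rangle>) (psnd p))"
proof -
  from assms obtain c d where cd: "\<And>n. eval c n (f n)" "\<And>n. eval d n (g n)"
    unfolding computable_def by blast
  have "eval (CPrec c d) \<langle>a, k\<rangle> (rec_nat (f a) (\<lambda>n b. g \<langle>a, \<langle>n, b\<rangle>\<rangle>) k)" for a k
    by (induction k) (auto intro: eval.prec_0 eval.prec_Suc cd)
  then have "eval (CPrec c d) p (rec_nat (f (pfst p)) (\<lambda>n b. g \<langle>pfst p, \<langle>n, b\<rangle>\<rangle>) (psnd p))" for p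
    by (metis prod.collapse prod_decode_inverse)
  then show ?thesis
    unfolding computable_def by blast
qed

lemma computable_pred:
  assumes "computable f"
  shows "computable (\<lambda>n. f n - 1)"
proof -
  have *: "computable (\<lambda>x. pfst (psnd x))"
    by (intro computable_fst computable_snd computable_id)
  have "rec_nat 0 (\<lambda>n b. n) k = k - 1" for k :: nat
    by (cases k) auto
  with computable_comp[OF computable_rec[OF computable_const[of 0] *]
      computable_pair[OF computable_id assms]]
  show ?thesis
    by simp
qed

lemma computable_if:
  assumes "computable h" "computable f" "computable g"
  shows "computable (\<lambda>n. if h n = 0 then f n else g n)"
proof -
  have *: "computable (\<lambda>x. g (pfst x))"
    by (rule computable_comp[OF assms(3) computable_fst[OF computable_id]])
  have "rec_nat a (\<lambda>n b. d) k = (if k = 0 then a else d)" for a d k :: nat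
    by (cases k) auto
  with computable_comp[OF computable_rec[OF assms(2) *] computable_pair[OF computable_id assms(1)]]
  show ?thesis
    by simp
qed

lemmas computable_intros = computable_id computable_pair computable_Suc computable_fst
  computable_snd computable_const computable_pred computable_if

primrec select :: "(nat \<Rightarrow> nat) list \<Rightarrow> nat \<Rightarrow> nat \<Rightarrow> nat" where
  "select [] t n = 0"
| "select (f # fs) t n = (if t = 0 then f n else select fs (t - 1) n)"

lemma computable_select:
  "computable t \<Longrightarrow> list_all computable fs \<Longrightarrow> computable (\<lambda>n. select fs (t n) n)"
proof (induction fs arbitrary: t)
  case Nil
  show ?case by (simp add: computable_const)
next
  case (Cons f fs)
  then have "computable (\<lambda>n. select fs (t n - 1) n)"
    using computable_pred[of t] by simp
  with Cons.prems show ?case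
    by (simp add: computable_if)
qed

text \<open>
  The machine that interprets codes has configurations \<open>\<langle>v, s\<rangle>\<close>, where \<open>v\<close> is the current value and \<open>s\<close> is a
  stack of instructions still to be applied to it; the empty stack is \<open>0\<close>. An instruction is the
  number of a code (tags \<open>0\<close> to \<open>7\<close>) or a continuation that remembers intermediate data:
  \<open>\<langle>8, \<langle>w, g\<rangle>\<rangle>\<close> and \<open>\<langle>9, a\<rangle>\<close> for the second component of a pair and for forming the pair,
  \<open>\<langle>10, \<langle>\<langle>a, n\<rangle>, g\<rangle>\<rangle>\<close> for the step of a primitive recursion, and \<open>\<langle>11, \<langle>\<langle>a, k\<rangle>, f\<rangle>\<rangle>\<close> for a
  minimization that has just evaluated \<open>f\<close> at \<open>\<langle>a, k\<rangle>\<close>. Keeping the recursion on a stack makes a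
  single step a mere case distinction, hence obviously computable.
\<close>

abbreviation push :: "nat \<Rightarrow> nat \<Rightarrow> nat" where "push x s \<equiv> Suc \<langle>x, s\<rangle>"

abbreviation rest :: "nat \<Rightarrow> nat" where "rest q \<equiv> psnd (psnd q)"
abbreviation frame_tag :: "nat \<Rightarrow> nat" where "frame_tag q \<equiv> pfst (pfst (psnd q))"
abbreviation frame_arg :: "nat \<Rightarrow> nat" where "frame_arg q \<equiv> psnd (pfst (psnd q))"

text \<open>
  The argument is \<open>\<langle>v, \<langle>i, s\<rangle>\<rangle>\<close> with \<open>i\<close> the topmost instruction; the entries of the list are indexed
  by its tag.
\<close>

definition exec :: "nat \<Rightarrow> nat" where
  "exec q = select
    [\<lambda>q. \<langle>0, rest q\<rangle>,
     \<lambda>q. \<langle>Suc (pfst q), rest q\<rangle>,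
     \<lambda>q. \<langle>pfst (pfst q), rest q\<rangle>,
     \<lambda>q. \<langle>psnd (pfst q), rest q\<rangle>,
     \<lambda>q. \<langle>pfst q, push (pfst (frame_arg q))
            (push \<langle>8, \<langle>pfst q, psnd (frame_arg q)\<rangle>\<rangle> (rest q))\<rangle>,
     \<lambda>q. \<langle>pfst q, push (psnd (frame_arg q)) (push (pfst (frame_arg q)) (rest q))\<rangle>,
     \<lambda>q. if psnd (pfst q) = 0
          then \<langle>pfst (pfst q), push (pfst (frame_arg q)) (rest q)\<rangle>
          else \<langle>\<langle>pfst (pfst q), psnd (pfst q) - 1\<rangle>, push (pfst (psnd q))
            (push \<langle>10, \<langle>\<langle>pfst (pfst q), psnd (pfst q) - 1\<rangle>, psnd (frame_arg q)\<rangle>\<rangle> (rest q))\<rangle>,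
     \<lambda>q. \<langle>\<langle>pfst q, 0\<rangle>, push (frame_arg q)
            (push \<langle>11, \<langle>\<langle>pfst q, 0\<rangle>, frame_arg q\<rangle>\<rangle> (rest q))\<rangle>,
     \<lambda>q. \<langle>pfst (frame_arg q), push (psnd (frame_arg q)) (push \<langle>9, pfst q\<rangle> (rest q))\<rangle>,
     \<lambda>q. \<langle>\<langle>frame_arg q, pfst q\<rangle>, rest q\<rangle>,
     \<lambda>q. \<langle>\<langle>pfst (pfst (frame_arg q)), \<langle>psnd (pfst (frame_arg q)), pfst q\<rangle>\<rangle>,
            push (psnd (frame_arg q)) (rest q)\<rangle>,
     \<lambda>q. if pfst q = 0 then \<langle>psnd (pfst (frame_arg q)), rest q\<rangle>
          else \<langle>\<langle>pfst (pfst (frame_arg q)), Suc (psnd (pfst (frame_arg q)))\<rangle>,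
            push (psnd (frame_arg q))
              (push \<langle>11, \<langle>\<langle>pfst (pfst (frame_arg q)), Suc (psnd (pfst (frame_arg q)))\<rangle>,
                 psnd (frame_arg q)\<rangle>\<rangle> (rest q))\<rangle>]
    (frame_tag q) q"

definition step :: "nat \<Rightarrow> nat"
  where "step p = (if psnd p = 0 then p else exec \<langle>pfst p, psnd p - 1\<rangle>)"

lemma computable_step: "computable step"
proof -
  have "computable exec"
    unfolding exec_def
    by (rule computable_select) (simp_all, (intro computable_intros conjI)+)
  then have "computable (\<lambda>p. exec \<langle>pfst p, psnd p - 1\<rangle>)"
    by (rule computable_comp) (intro computable_intros)
  then show ?thesis
    unfolding step_def by (intro computable_intros)
qed

lemma step_simps:
  "step \<langle>v, 0\<rangle> = \<langle>v, 0\<rangle>"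
  "step \<langle>v, push \<langle>0, x\<rangle> s\<rangle> = \<langle>0, s\<rangle>"
  "step \<langle>v, push \<langle>Suc 0, x\<rangle> s\<rangle> = \<langle>Suc v, s\<rangle>"
  "step \<langle>\<langle>a, b\<rangle>, push \<langle>2, x\<rangle> s\<rangle> = \<langle>a, s\<rangle>"
  "step \<langle>\<langle>a, b\<rangle>, push \<langle>3, x\<rangle> s\<rangle> = \<langle>b, s\<rangle>"
  "step \<langle>v, push \<langle>4, \<langle>f, g\<rangle>\<rangle> s\<rangle> = \<langle>v, push f (push \<langle>8, \<langle>v, g\<rangle>\<rangle> s)\<rangle>"
  "step \<langle>v, push \<langle>5, \<langle>f, g\<rangle>\<rangle> s\<rangle> = \<langle>v, push g (push f s)\<rangle>"
  "step \<langle>\<langle>a, 0\<rangle>, push \<langle>6, \<langle>f, g\<rangle>\<rangle> s\<rangle> = \<langle>a, push f s\<rangle>"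
  "step \<langle>\<langle>a, Suc n\<rangle>, push \<langle>6, \<langle>f, g\<rangle>\<rangle> s\<rangle> =
     \<langle>\<langle>a, n\<rangle>, push \<langle>6, \<langle>f, g\<rangle>\<rangle> (push \<langle>10, \<langle>\<langle>a, n\<rangle>, g\<rangle>\<rangle> s)\<rangle>"
  "step \<langle>v, push \<langle>7, f\<rangle> s\<rangle> = \<langle>\<langle>v, 0\<rangle>, push f (push \<langle>11, \<langle>\<langle>v, 0\<rangle>, f\<rangle>\<rangle> s)\<rangle>"
  "step \<langle>a, push \<langle>8, \<langle>v, g\<rangle>\<rangle> s\<rangle> = \<langle>v, push g (push \<langle>9, a\<rangle> s)\<rangle>"
  "step \<langle>b, push \<langle>9, a\<rangle> s\<rangle> = \<langle>\<langle>a, b\<rangle>, s\<rangle>"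
  "step \<langle>b, push \<langle>10, \<langle>\<langle>a, n\<rangle>, g\<rangle>\<rangle> s\<rangle> = \<langle>\<langle>a, \<langle>n, b\<rangle>\<rangle>, push g s\<rangle>"
  "step \<langle>0, push \<langle>11, \<langle>\<langle>a, k\<rangle>, f\<rangle>\<rangle> s\<rangle> = \<langle>k, s\<rangle>"
  "step \<langle>Suc m, push \<langle>11, \<langle>\<langle>a, k\<rangle>, f\<rangle>\<rangle> s\<rangle> =
     \<langle>\<langle>a, Suc k\<rangle>, push f (push \<langle>11, \<langle>\<langle>a, Suc k\<rangle>, f\<rangle>\<rangle> s)\<rangle>"
  by (simp_all add: step_def exec_def)

definition reaches :: "nat \<Rightarrow> nat \<Rightarrow> bool"
  where "reaches p q \<longleftrightarrow> (\<exists>k. (step ^^ k) p = q)"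

lemma reaches_refl: "reaches p p"
  unfolding reaches_def by (rule exI[of _ 0]) simp

lemma reaches_step: "reaches (step p) q \<Longrightarrow> reaches p q"
  unfolding reaches_def by (metis comp_apply funpow_Suc_right)

lemma reaches_trans: "reaches p q \<Longrightarrow> reaches q r \<Longrightarrow> reaches p r"
  unfolding reaches_def by (metis comp_apply funpow_add)

text \<open>
  The stack \<open>s\<close> below the instruction is arbitrary and remains untouched. This is what lets the
  evaluations of the parts of a code be chained.
\<close>

lemma machine_evaluates:
  "eval c n m \<Longrightarrow> reaches \<langle>n, push (gnum c) s\<rangle> \<langle>m, s\<rangle>"
proof (induction arbitrary: s rule: eval.induct)
  case (zero n)
  show ?case by (rule reaches_step) (simp add: step_simps reaches_refl)
next
  case (succ n)
  show ?case by (rule reaches_step) (simp add: step_simps reaches_refl)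
next
  case (fst a b)
  show ?case by (rule reaches_step) (simp add: step_simps reaches_refl)
next
  case (snd a b)
  show ?case by (rule reaches_step) (simp add: step_simps reaches_refl)
next
  case (pair f n a g b)
  have "reaches \<langle>a, push \<langle>8, \<langle>n, gnum g\<rangle>\<rangle> s\<rangle> \<langle>\<langle>a, b\<rangle>, s\<rangle>"
    by (rule reaches_step, simp add: step_simps, rule reaches_trans[OF pair.IH(2)], rule reaches_step)
      (simp add: step_simps reaches_refl)
  then show ?case
    by (intro reaches_step[of "\<langle>n, _\<rangle>"])
      (simp add: step_simps reaches_trans[OF pair.IH(1)])
next
  case (comp g n a f b)
  then show ?case
    by (intro reaches_step[of "\<langle>n, _\<rangle>"]) (simp add: step_simps reaches_trans[OF comp.IH(1)])
next
  case (prec_0 f a b g)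
  then show ?case
    by (intro reaches_step[of "\<langle>_, push (gnum (CPrec f g)) s\<rangle>"]) (simp add: step_simps)
next
  case (prec_Suc f g a n b c)
  have "reaches \<langle>b, push \<langle>10, \<langle>\<langle>a, n\<rangle>, gnum g\<rangle>\<rangle> s\<rangle> \<langle>c, s\<rangle>"
    by (rule reaches_step) (simp add: step_simps prec_Suc.IH(2))
  then have "reaches \<langle>\<langle>a, n\<rangle>, push (gnum (CPrec f g)) (push \<langle>10, \<langle>\<langle>a, n\<rangle>, gnum g\<rangle>\<rangle> s)\<rangle> \<langle>c, s\<rangle>"
    by (rule reaches_trans[OF prec_Suc.IH(1)])
  then show ?case
    by (intro reaches_step[of "\<langle>_, push (gnum (CPrec f g)) s\<rangle>"]) (simp add: step_simps)
next
  case (min f a k)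
  let ?at = "\<lambda>j. \<langle>\<langle>a, j\<rangle>, push (gnum f) (push \<langle>11, \<langle>\<langle>a, j\<rangle>, gnum f\<rangle>\<rangle> s)\<rangle>"
  have "reaches (?at 0) (?at j)" if "j \<le> k" for j
    using that
  proof (induction j)
    case 0
    show ?case by (rule reaches_refl)
  next
    case (Suc j)
    with min.IH(2) obtain m where
      "reaches (?at j) \<langle>Suc m, push \<langle>11, \<langle>\<langle>a, j\<rangle>, gnum f\<rangle>\<rangle> s\<rangle>"
      by (meson Suc_le_lessD)
    moreover have "reaches \<langle>Suc m, push \<langle>11, \<langle>\<langle>a, j\<rangle>, gnum f\<rangle>\<rangle> s\<rangle> (?at (Suc j))"
      by (rule reaches_step) (simp add: step_simps reaches_refl)
    ultimately show ?case
      using Suc by (meson Suc_leD reaches_trans)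
  qed
  moreover have "reaches (?at k) \<langle>0, push \<langle>11, \<langle>\<langle>a, k\<rangle>, gnum f\<rangle>\<rangle> s\<rangle>"
    by (rule min.IH(1))
  moreover have "reaches \<langle>0, push \<langle>11, \<langle>\<langle>a, k\<rangle>, gnum f\<rangle>\<rangle> s\<rangle> \<langle>k, s\<rangle>"
    by (rule reaches_step) (simp add: step_simps reaches_refl)
  ultimately have "reaches (?at 0) \<langle>k, s\<rangle>"
    by (meson order_refl reaches_trans)
  then show ?case
    by (intro reaches_step[of "\<langle>a, _\<rangle>"]) (simp add: step_simps)
qed

lemma computable_iterate: "computable (\<lambda>p. (step ^^ psnd p) (pfst p))"
proof -
  have "computable (\<lambda>x. step (psnd (psnd x)))"
    by (rule computable_comp[OF computable_step]) (intro computable_intros)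
  moreover have "rec_nat a (\<lambda>n b. step b) k = (step ^^ k) a" for a k
    by (induction k) auto
  ultimately show ?thesis
    using computable_rec[of "\<lambda>n. n" "\<lambda>x. step (psnd (psnd x))"] computable_id by simp
qed

text \<open>
  Run the machine until the stack is empty. Configurations with empty stack are fixed by \<open>step\<close>, so
  the first such configuration is the one that carries the result.
\<close>

lemma universal_code:
  obtains u where "\<And>e n m. kapp e n m \<Longrightarrow> eval u \<langle>e, n\<rangle> m"
proof -
  from computable_iterate obtain it where
    it: "\<And>p. eval it p ((step ^^ psnd p) (pfst p))"
    unfolding computable_def by blast
  have "computable (\<lambda>p. \<langle>psnd p, push (pfst p) 0\<rangle>)"
    by (intro computable_intros)
  then obtain init where init: "\<And>p. eval init p \<langle>psnd p, push (pfst p) 0\<rangle>"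
    unfolding computable_def by blast
  define halt where "halt = CMin (CComp CSnd it)"
  define u where "u = CComp CFst (CComp it (CPair init (CComp halt init)))"
  have "eval u \<langle>e, n\<rangle> m" if "kapp e n m" for e n m
  proof -
    let ?p = "\<langle>n, push e 0\<rangle>"
    let ?q = "\<lambda>k. (step ^^ k) ?p"
    from that obtain l where l: "?q l = \<langle>m, 0\<rangle>"
      unfolding kapp_def by (metis machine_evaluates reaches_def)
    define k where "k = (LEAST k. psnd (?q k) = 0)"
    have k0: "psnd (?q k) = 0"
      unfolding k_def by (rule LeastI[of _ l]) (simp add: l)
    have "k \<le> l"
      unfolding k_def by (rule Least_le) (simp add: l)
    have step_k: "step (?q k) = ?q k"
      using k0 by (simp add: step_def)
    have "?q (k + j) = ?q k" for j
      by (induction j) (simp_all add: step_k)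
    with \<open>k \<le> l\<close> l have qk: "?q k = \<langle>m, 0\<rangle>"
      by (metis le_add_diff_inverse)
    have before: "\<exists>j'. psnd (?q j) = Suc j'" if "j < k" for j
      using not_less_Least[OF that[unfolded k_def]] by (metis nat.exhaust)
    have test: "eval (CComp CSnd it) \<langle>?p, j\<rangle> (psnd (?q j))" for j
      using eval.comp[OF it eval_CSnd, of "\<langle>?p, j\<rangle>"] by simp
    have "eval halt ?p k"
      unfolding halt_def using k0 before by (intro eval.min) (metis test)+
    moreover have "eval init \<langle>e, n\<rangle> ?p"
      using init[of "\<langle>e, n\<rangle>"] by simp
    ultimately have "eval (CPair init (CComp halt init)) \<langle>e, n\<rangle> \<langle>?p, k\<rangle>"
      by (intro eval.pair eval.comp)
    moreover have "eval it \<langle>?p, k\<rangle> \<langle>m, 0\<rangle>"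
      using it[of "\<langle>?p, k\<rangle>"] qk by simp
    ultimately show ?thesis
      unfolding u_def by (blast intro: eval.comp eval.fst)
  qed
  with that show thesis .
qed

section \<open>Forcing at generalized elements\<close>

text \<open>
  This is truth at a generalized element: \<open>'e\<close> indexes a family of points and \<open>r\<close> the realizers that
  are available for them. One code must turn \<open>r e\<close> into a realizer of \<open>Q e\<close> for all \<open>e\<close>. Points of
  objects become functions on \<open>'e\<close>.
\<close>

definition forces :: "('e \<Rightarrow> nat) \<Rightarrow> ('e \<Rightarrow> nat set) \<Rightarrow> bool"
  where "forces r Q \<longleftrightarrow> (\<exists>c. \<forall>e. runs c (r e) (Q e))"

lemma forces_conj [simp]:
  "forces r (\<lambda>e. P e \<^bold>\<and> Q e) \<longleftrightarrow> forces r P \<and> forces r Q"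
  unfolding forces_def by (meson runs_fst runs_pair runs_snd)

text \<open>
  The witness \<open>y\<close> is a function of the index alone and need not be computable, since points carry no
  information apart from their realizers; it comes from the axiom of choice.
\<close>

lemma forces_UN:
  "forces r (\<lambda>e. \<Union>y\<in>Y. Q e y) \<longleftrightarrow> (\<exists>y. (\<forall>e. y e \<in> Y) \<and> forces r (\<lambda>e. Q e (y e)))"
proof
  assume "forces r (\<lambda>e. \<Union>y\<in>Y. Q e y)"
  then obtain c where "\<forall>e. \<exists>y\<in>Y. runs c (r e) (Q e y)"
    unfolding forces_def by (meson runs_UN_E)
  then obtain y where "\<forall>e. y e \<in> Y \<and> runs c (r e) (Q e (y e))"
    by metis
  then show "\<exists>y. (\<forall>e. y e \<in> Y) \<and> forces r (\<lambda>e. Q e (y e))"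
    unfolding forces_def by blast
next
  assume "\<exists>y. (\<forall>e. y e \<in> Y) \<and> forces r (\<lambda>e. Q e (y e))"
  then show "forces r (\<lambda>e. \<Union>y\<in>Y. Q e y)"
    unfolding forces_def by (metis runs_UN)
qed

lemma forces_uniform: "(\<And>e. n \<in> Q e) \<Longrightarrow> forces r Q"
  using computable_const[of n] unfolding forces_def computable_def runs_def by blast

lemma forces_inhabited: "forces r Q \<Longrightarrow> Q e \<noteq> {}"
  unfolding forces_def runs_def by blast

text \<open>
  Over a one-point family nothing has to be uniform, so that \<open>forces\<close> reduces to inhabitedness. Rules
  for \<open>forces\<close> therefore specialize to rules for supports.
\<close>

lemma forces_point [simp]: "forces r (\<lambda>_ :: unit. Q) \<longleftrightarrow> Q \<noteq> {}"
  by (metis all_not_in_conv forces_inhabited forces_uniform)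

text \<open>
  The realizer of the implication is not a fixed number but is itself computed from \<open>r e\<close>. Applying it
  requires the universal function.
\<close>

lemma forces_mp:
  assumes "forces r (\<lambda>e. P e \<^bold>\<longrightarrow> Q e)" and "forces r P"
  shows "forces r Q"
proof -
  from assms obtain c d where c: "\<And>e. runs c (r e) (P e \<^bold>\<longrightarrow> Q e)" and d: "\<And>e. runs d (r e) (P e)"
    unfolding forces_def by blast
  from universal_code obtain u where u: "\<And>k n m. kapp k n m \<Longrightarrow> eval u \<langle>k, n\<rangle> m"
    by blast
  have "runs (CComp u (CPair c d)) (r e) (Q e)" for e
    using runs_pair[OF c d]
    by (rule runs_comp) (auto simp: rconj_def rimp_def runs_def intro: u)
  then show ?thesis
    unfolding forces_def by blast
qed

lemma rneg_rneg: "(\<^bold>\<not> \<^bold>\<not> P) = (if P = {} then {} else UNIV)"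
  by (auto simp: rneg_def rimp_def)

lemma forces_notnot [simp]: "forces r (\<lambda>e. \<^bold>\<not> \<^bold>\<not> P e) \<longleftrightarrow> (\<forall>e. P e \<noteq> {})"
proof
  assume "forces r (\<lambda>e. \<^bold>\<not> \<^bold>\<not> P e)"
  then show "\<forall>e. P e \<noteq> {}"
    by (metis forces_inhabited rneg_rneg)
next
  assume "\<forall>e. P e \<noteq> {}"
  then show "forces r (\<lambda>e. \<^bold>\<not> \<^bold>\<not> P e)"
    by (intro forces_uniform[of 0]) (simp add: rneg_rneg)
qed

lemma valid_imp_forces:
  assumes "valid (\<Inter>i\<in>I. P i \<^bold>\<longrightarrow> Q i)" and "\<forall>e. x e \<in> I" and "forces r (\<lambda>e. P (x e))"
  shows "forces r (\<lambda>e. Q (x e))"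
proof -
  from assms(1) obtain c where c: "\<And>i p. i \<in> I \<Longrightarrow> p \<in> P i \<Longrightarrow> runs c p (Q i)"
    unfolding valid_imp_code by blast
  from assms(3) obtain d where d: "\<And>e. runs d (r e) (P (x e))"
    unfolding forces_def by blast
  have "runs (CComp c d) (r e) (Q (x e))" for e
    using d assms(2) by (intro runs_comp c) auto
  then show ?thesis
    unfolding forces_def by blast
qed

text \<open>
  The generic case: the family of all points together with all realizers of the premise. Indices
  that are not of this form are redirected to a fixed one of this form, so that a total type can serve
  as the index set. If there is none, then the premises have no realizers and any number will do.
\<close>

lemma valid_impI:
  fixes I :: "'i set"
  assumes "\<And>(r :: 'i \<times> nat \<Rightarrow> nat) x. \<forall>e. x e \<in> I \<Longrightarrow> forces r (\<lambda>e. P (x e)) \<Longrightarrow> forces r (\<lambda>e. Q (x e))"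
  shows "valid (\<Inter>i\<in>I. P i \<^bold>\<longrightarrow> Q i)"
proof (cases "\<exists>i\<in>I. P i \<noteq> {}")
  case False
  then have "0 \<in> (\<Inter>i\<in>I. P i \<^bold>\<longrightarrow> Q i)"
    by (auto simp: rimp_def)
  then show ?thesis
    unfolding valid_def by blast
next
  case True
  then obtain i p where ip: "i \<in> I" "p \<in> P i"
    by blast
  define good where "good = (\<lambda>e. if fst e \<in> I \<and> snd e \<in> P (fst e) then e else (i, p))"
  have "forces (snd \<circ> good) (\<lambda>e. P (fst (good e)))"
    unfolding forces_def by (rule exI[of _ "CPair CFst CSnd"]) (simp add: good_def ip runs_id)
  then have "forces (snd \<circ> good) (\<lambda>e. Q (fst (good e)))"
    by (rule assms[rotated]) (simp add: good_def ip)
  then obtain c where c: "\<And>e. runs c (snd (good e)) (Q (fst (good e)))"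
    unfolding forces_def by auto
  have "runs c p (Q i)" if "i \<in> I" "p \<in> P i" for i p
    using c[of "(i, p)"] that by (simp add: good_def)
  then show ?thesis
    unfolding valid_imp_code by blast
qed

lemma INT_pairs:
  "(\<Inter>x\<in>A. \<Inter>y\<in>B. P x y) = (\<Inter>i\<in>A \<times> B. P (fst i) (snd i))"
  by auto

lemma INT_triples:
  "(\<Inter>x\<in>A. \<Inter>y\<in>B. \<Inter>z\<in>C. P x y z) = (\<Inter>i\<in>A \<times> B \<times> C. P (fst i) (fst (snd i)) (snd (snd i)))"
  by auto

lemma INT_quadruples:
  "(\<Inter>x\<in>A. \<Inter>y\<in>B. \<Inter>z\<in>C. \<Inter>w\<in>D. P x y z w) =
   (\<Inter>i\<in>A \<times> B \<times> C \<times> D. P (fst i) (fst (snd i)) (fst (snd (snd i))) (snd (snd (snd i))))"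
  by auto

lemma valid_imp_forces2:
  assumes "valid (\<Inter>x\<in>A. \<Inter>y\<in>B. P x y \<^bold>\<longrightarrow> Q x y)"
    and "\<forall>e. x e \<in> A" "\<forall>e. y e \<in> B" "forces r (\<lambda>e. P (x e) (y e))"
  shows "forces r (\<lambda>e. Q (x e) (y e))"
  using valid_imp_forces[OF assms(1)[unfolded INT_pairs], of "\<lambda>e. (x e, y e)"] assms(2-) by simp

lemma valid_imp_forces3:
  assumes "valid (\<Inter>x\<in>A. \<Inter>y\<in>B. \<Inter>z\<in>C. P x y z \<^bold>\<longrightarrow> Q x y z)"
    and "\<forall>e. x e \<in> A" "\<forall>e. y e \<in> B" "\<forall>e. z e \<in> C" "forces r (\<lambda>e. P (x e) (y e) (z e))"
  shows "forces r (\<lambda>e. Q (x e) (y e) (z e))"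
  using valid_imp_forces[OF assms(1)[unfolded INT_triples], of "\<lambda>e. (x e, y e, z e)"] assms(2-)
  by simp

lemma valid_imp_forces4:
  assumes "valid (\<Inter>x\<in>A. \<Inter>y\<in>B. \<Inter>z\<in>C. \<Inter>w\<in>D. P x y z w \<^bold>\<longrightarrow> Q x y z w)"
    and "\<forall>e. x e \<in> A" "\<forall>e. y e \<in> B" "\<forall>e. z e \<in> C" "\<forall>e. w e \<in> D"
    and "forces r (\<lambda>e. P (x e) (y e) (z e) (w e))"
  shows "forces r (\<lambda>e. Q (x e) (y e) (z e) (w e))"
  using valid_imp_forces[OF assms(1)[unfolded INT_quadruples], of "\<lambda>e. (x e, y e, z e, w e)"] assms(2-)
  by simp

lemma valid_impI2:
  fixes A :: "'a set" and B :: "'b set"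
  assumes "\<And>(r :: ('a \<times> 'b) \<times> nat \<Rightarrow> nat) x y. \<forall>e. x e \<in> A \<Longrightarrow> \<forall>e. y e \<in> B \<Longrightarrow>
    forces r (\<lambda>e. P (x e) (y e)) \<Longrightarrow> forces r (\<lambda>e. Q (x e) (y e))"
  shows "valid (\<Inter>x\<in>A. \<Inter>y\<in>B. P x y \<^bold>\<longrightarrow> Q x y)"
  unfolding INT_pairs by (rule valid_impI, rule assms) (simp_all add: mem_Times_iff)

lemma valid_impI3:
  fixes A :: "'a set" and B :: "'b set" and C :: "'c set"
  assumes "\<And>(r :: ('a \<times> 'b \<times> 'c) \<times> nat \<Rightarrow> nat) x y z.
    \<forall>e. x e \<in> A \<Longrightarrow> \<forall>e. y e \<in> B \<Longrightarrow> \<forall>e. z e \<in> C \<Longrightarrow>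
    forces r (\<lambda>e. P (x e) (y e) (z e)) \<Longrightarrow> forces r (\<lambda>e. Q (x e) (y e) (z e))"
  shows "valid (\<Inter>x\<in>A. \<Inter>y\<in>B. \<Inter>z\<in>C. P x y z \<^bold>\<longrightarrow> Q x y z)"
  unfolding INT_triples by (rule valid_impI, rule assms) (simp_all add: mem_Times_iff)

lemma valid_impI4:
  fixes A :: "'a set" and B :: "'b set" and C :: "'c set" and D :: "'d set"
  assumes "\<And>(r :: ('a \<times> 'b \<times> 'c \<times> 'd) \<times> nat \<Rightarrow> nat) x y z w.
    \<forall>e. x e \<in> A \<Longrightarrow> \<forall>e. y e \<in> B \<Longrightarrow> \<forall>e. z e \<in> C \<Longrightarrow> \<forall>e. w e \<in> D \<Longrightarrow>
    forces r (\<lambda>e. P (x e) (y e) (z e) (w e)) \<Longrightarrow> forces r (\<lambda>e. Q (x e) (y e) (z e) (w e))"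
  shows "valid (\<Inter>x\<in>A. \<Inter>y\<in>B. \<Inter>z\<in>C. \<Inter>w\<in>D. P x y z w \<^bold>\<longrightarrow> Q x y z w)"
  unfolding INT_quadruples by (rule valid_impI, rule assms) (simp_all add: mem_Times_iff)

section \<open>Objects and morphisms\<close>

text \<open>
  Index types are products, but the members of a family must keep the form \<open>x e\<close> for the rules about
  \<^const>\<open>forces\<close> to match.
\<close>

declare split_paired_All [simp del] split_paired_Ex [simp del]

lemma forces_sym:
  assumes "eff_object X" "\<forall>e. x e \<in> pts X" "\<forall>e. y e \<in> pts X" "forces r (\<lambda>e. eql X (x e) (y e))"
  shows "forces r (\<lambda>e. eql X (y e) (x e))"
proof -
  from assms(1) have "valid (\<Inter>x\<in>pts X. \<Inter>y\<in>pts X. eql X x y \<^bold>\<longrightarrow> eql X y x)"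
    unfolding eff_object_def by blast
  from valid_imp_forces2[OF this assms(2-)] show ?thesis .
qed

lemma forces_trans:
  assumes "eff_object X" "\<forall>e. x e \<in> pts X" "\<forall>e. y e \<in> pts X" "\<forall>e. z e \<in> pts X"
    "forces r (\<lambda>e. eql X (x e) (y e))" "forces r (\<lambda>e. eql X (y e) (z e))"
  shows "forces r (\<lambda>e. eql X (x e) (z e))"
proof -
  from assms(1) have
    "valid (\<Inter>x\<in>pts X. \<Inter>y\<in>pts X. \<Inter>z\<in>pts X. (eql X x y \<^bold>\<and> eql X y z) \<^bold>\<longrightarrow> eql X x z)"
    unfolding eff_object_def by blast
  from valid_imp_forces3[OF this assms(2-4)] assms(5-) show ?thesis
    by simp
qed

lemma forces_ext:
  assumes "eff_object X" "\<forall>e. x e \<in> pts X" "\<forall>e. y e \<in> pts X" "forces r (\<lambda>e. eql X (x e) (y e))"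
  shows "forces r (\<lambda>e. ext X (x e))" "forces r (\<lambda>e. ext X (y e))"
  unfolding ext_def using assms by (blast intro: forces_sym forces_trans)+

lemma eff_objectI:
  fixes X :: "'a eff_obj"
  assumes "\<And>(r :: ('a \<times> 'a) \<times> nat \<Rightarrow> nat) x y. \<forall>e. x e \<in> pts X \<Longrightarrow> \<forall>e. y e \<in> pts X \<Longrightarrow>
      forces r (\<lambda>e. eql X (x e) (y e)) \<Longrightarrow> forces r (\<lambda>e. eql X (y e) (x e))"
    and "\<And>(r :: ('a \<times> 'a \<times> 'a) \<times> nat \<Rightarrow> nat) x y z.
      \<forall>e. x e \<in> pts X \<Longrightarrow> \<forall>e. y e \<in> pts X \<Longrightarrow> \<forall>e. z e \<in> pts X \<Longrightarrow>
      forces r (\<lambda>e. eql X (x e) (y e)) \<Longrightarrow> forces r (\<lambda>e. eql X (y e) (z e)) \<Longrightarrow>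
      forces r (\<lambda>e. eql X (x e) (z e))"
  shows "eff_object X"
  unfolding eff_object_def
proof (intro conjI)
  show "valid (\<Inter>x\<in>pts X. \<Inter>y\<in>pts X. eql X x y \<^bold>\<longrightarrow> eql X y x)"
    by (rule valid_impI2, rule assms(1)) 
  show "valid (\<Inter>x\<in>pts X. \<Inter>y\<in>pts X. \<Inter>z\<in>pts X. (eql X x y \<^bold>\<and> eql X y z) \<^bold>\<longrightarrow> eql X x z)"
    by (rule valid_impI3) (simp, blast intro: assms(2))
qed

lemma morphism_strict:
  assumes "eff_morphism X Y F" "\<forall>e. x e \<in> pts X" "\<forall>e. y e \<in> pts Y" "forces r (\<lambda>e. F (x e) (y e))"
  shows "forces r (\<lambda>e. ext X (x e))" "forces r (\<lambda>e. ext Y (y e))"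
proof -
  from assms(1) have "valid (\<Inter>x\<in>pts X. \<Inter>y\<in>pts Y. F x y \<^bold>\<longrightarrow> (ext X x \<^bold>\<and> ext Y y))"
    unfolding eff_morphism_def by blast
  from valid_imp_forces2[OF this assms(2-)]
  show "forces r (\<lambda>e. ext X (x e))" "forces r (\<lambda>e. ext Y (y e))"
    by simp_all
qed

lemma morphism_rel:
  assumes "eff_morphism X Y F" "\<forall>e. x e \<in> pts X" "\<forall>e. x' e \<in> pts X" "\<forall>e. y e \<in> pts Y" "\<forall>e. y' e \<in> pts Y"
    and "forces r (\<lambda>e. F (x e) (y e))"
    and "forces r (\<lambda>e. eql X (x e) (x' e))" "forces r (\<lambda>e. eql Y (y e) (y' e))"
  shows "forces r (\<lambda>e. F (x' e) (y' e))"
proof -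
  from assms(1) have "valid (\<Inter>x\<in>pts X. \<Inter>x'\<in>pts X. \<Inter>y\<in>pts Y. \<Inter>y'\<in>pts Y.
      (F x y \<^bold>\<and> eql X x x' \<^bold>\<and> eql Y y y') \<^bold>\<longrightarrow> F x' y')"
    unfolding eff_morphism_def by blast
  from valid_imp_forces4[OF this assms(2-5)] assms(6-) show ?thesis
    by simp
qed

lemma morphism_single:
  assumes "eff_morphism X Y F" "\<forall>e. x e \<in> pts X" "\<forall>e. y e \<in> pts Y" "\<forall>e. y' e \<in> pts Y"
    and "forces r (\<lambda>e. F (x e) (y e))" "forces r (\<lambda>e. F (x e) (y' e))"
  shows "forces r (\<lambda>e. eql Y (y e) (y' e))"
proof -
  from assms(1) have "valid (\<Inter>x\<in>pts X. \<Inter>y\<in>pts Y. \<Inter>y'\<in>pts Y. (F x y \<^bold>\<and> F x y') \<^bold>\<longrightarrow> eql Y y y')"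
    unfolding eff_morphism_def by blast
  from valid_imp_forces3[OF this assms(2-4)] assms(5-) show ?thesis
    by simp
qed

lemma morphism_total:
  assumes "eff_morphism X Y F" "\<forall>e. x e \<in> pts X" "forces r (\<lambda>e. ext X (x e))"
  obtains y where "\<forall>e. y e \<in> pts Y" "forces r (\<lambda>e. F (x e) (y e))"
proof -
  from assms(1) have "valid (\<Inter>x\<in>pts X. ext X x \<^bold>\<longrightarrow> (\<Union>y\<in>pts Y. F x y))"
    unfolding eff_morphism_def by blast
  from valid_imp_forces[OF this assms(2,3)] that show thesis
    unfolding forces_UN by blast
qed

lemma eff_morphismI:
  fixes X :: "'a eff_obj" and Y :: "'b eff_obj"
  assumes "\<And>(r :: ('a \<times> 'b) \<times> nat \<Rightarrow> nat) x y. \<forall>e. x e \<in> pts X \<Longrightarrow> \<forall>e. y e \<in> pts Y \<Longrightarrow>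
      forces r (\<lambda>e. F (x e) (y e)) \<Longrightarrow> forces r (\<lambda>e. ext X (x e)) \<and> forces r (\<lambda>e. ext Y (y e))"
    and "\<And>(r :: ('a \<times> 'a \<times> 'b \<times> 'b) \<times> nat \<Rightarrow> nat) x x' y y'.
      \<forall>e. x e \<in> pts X \<Longrightarrow> \<forall>e. x' e \<in> pts X \<Longrightarrow> \<forall>e. y e \<in> pts Y \<Longrightarrow> \<forall>e. y' e \<in> pts Y \<Longrightarrow>
      forces r (\<lambda>e. F (x e) (y e)) \<Longrightarrow> forces r (\<lambda>e. eql X (x e) (x' e)) \<Longrightarrow>
      forces r (\<lambda>e. eql Y (y e) (y' e)) \<Longrightarrow> forces r (\<lambda>e. F (x' e) (y' e))"
    and "\<And>(r :: ('a \<times> 'b \<times> 'b) \<times> nat \<Rightarrow> nat) x y y'.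
      \<forall>e. x e \<in> pts X \<Longrightarrow> \<forall>e. y e \<in> pts Y \<Longrightarrow> \<forall>e. y' e \<in> pts Y \<Longrightarrow>
      forces r (\<lambda>e. F (x e) (y e)) \<Longrightarrow> forces r (\<lambda>e. F (x e) (y' e)) \<Longrightarrow>
      forces r (\<lambda>e. eql Y (y e) (y' e))"
    and "\<And>(r :: 'a \<times> nat \<Rightarrow> nat) x. \<forall>e. x e \<in> pts X \<Longrightarrow> forces r (\<lambda>e. ext X (x e)) \<Longrightarrow>
      \<exists>y. (\<forall>e. y e \<in> pts Y) \<and> forces r (\<lambda>e. F (x e) (y e))"
  shows "eff_morphism X Y F"
  unfolding eff_morphism_def
proof (intro conjI)
  show "valid (\<Inter>x\<in>pts X. \<Inter>y\<in>pts Y. F x y \<^bold>\<longrightarrow> (ext X x \<^bold>\<and> ext Y y))"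
    by (rule valid_impI2) (simp add: assms(1))
  show "valid (\<Inter>x\<in>pts X. \<Inter>x'\<in>pts X. \<Inter>y\<in>pts Y. \<Inter>y'\<in>pts Y.
      (F x y \<^bold>\<and> eql X x x' \<^bold>\<and> eql Y y y') \<^bold>\<longrightarrow> F x' y')"
    by (rule valid_impI4) (simp, blast intro: assms(2))
  show "valid (\<Inter>x\<in>pts X. \<Inter>y\<in>pts Y. \<Inter>y'\<in>pts Y. (F x y \<^bold>\<and> F x y') \<^bold>\<longrightarrow> eql Y y y')"
    by (rule valid_impI3) (simp, blast intro: assms(3))
  show "valid (\<Inter>x\<in>pts X. ext X x \<^bold>\<longrightarrow> (\<Union>y\<in>pts Y. F x y))"
    by (rule valid_impI) (simp add: forces_UN assms(4))
qed

lemma eff_eqI: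
  fixes X :: "'a eff_obj" and Y :: "'b eff_obj"
  assumes "\<And>(r :: ('a \<times> 'b) \<times> nat \<Rightarrow> nat) x y. \<forall>e. x e \<in> pts X \<Longrightarrow> \<forall>e. y e \<in> pts Y \<Longrightarrow>
      forces r (\<lambda>e. F (x e) (y e)) \<Longrightarrow> forces r (\<lambda>e. G (x e) (y e))"
    and "\<And>(r :: ('a \<times> 'b) \<times> nat \<Rightarrow> nat) x y. \<forall>e. x e \<in> pts X \<Longrightarrow> \<forall>e. y e \<in> pts Y \<Longrightarrow>
      forces r (\<lambda>e. G (x e) (y e)) \<Longrightarrow> forces r (\<lambda>e. F (x e) (y e))"
  shows "eff_eq X Y F G"
proof -
  have "valid (\<Inter>x\<in>pts X. \<Inter>y\<in>pts Y. F x y \<^bold>\<longrightarrow> G x y)"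
    by (rule valid_impI2) (rule assms(1))
  moreover have "valid (\<Inter>x\<in>pts X. \<Inter>y\<in>pts Y. G x y \<^bold>\<longrightarrow> F x y)"
    by (rule valid_impI2) (rule assms(2))
  ultimately show ?thesis
    unfolding eff_eq_def valid_codes by blast
qed

lemma forces_eff_eq:
  assumes "eff_eq X Y F G" "\<forall>e. x e \<in> pts X" "\<forall>e. y e \<in> pts Y"
  shows "forces r (\<lambda>e. F (x e) (y e)) \<longleftrightarrow> forces r (\<lambda>e. G (x e) (y e))"
proof -
  from assms(1) have "valid (\<Inter>x\<in>pts X. \<Inter>y\<in>pts Y. F x y \<^bold>\<longrightarrow> G x y)"
    "valid (\<Inter>x\<in>pts X. \<Inter>y\<in>pts Y. G x y \<^bold>\<longrightarrow> F x y)"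
    unfolding eff_eq_def valid_codes by blast+
  then show ?thesis
    using valid_imp_forces2[OF _ assms(2,3), of F G] valid_imp_forces2[OF _ assms(2,3), of G F]
    by blast
qed

lemma pts_prod [simp]: "pts (eff_prod X Y) = pts X \<times> pts Y"
  by (simp add: eff_prod_def)

lemma eql_prod [simp]: "eql (eff_prod X Y) p q = (eql X (fst p) (fst q) \<^bold>\<and> eql Y (snd p) (snd q))"
  by (simp add: eff_prod_def case_prod_beta)

lemma ext_prod [simp]: "ext (eff_prod X Y) p = (ext X (fst p) \<^bold>\<and> ext Y (snd p))"
  by (simp add: ext_def)

lemma object_prod:
  assumes "eff_object X" "eff_object Y"
  shows "eff_object (eff_prod X Y)"
proof (rule eff_objectI)
  fix r :: "(('a \<times> 'b) \<times> 'a \<times> 'b) \<times> nat \<Rightarrow> nat" and x y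
  assume "\<forall>e. x e \<in> pts (eff_prod X Y)" "\<forall>e. y e \<in> pts (eff_prod X Y)"
    "forces r (\<lambda>e. eql (eff_prod X Y) (x e) (y e))"
  then show "forces r (\<lambda>e. eql (eff_prod X Y) (y e) (x e))"
    by (simp add: mem_Times_iff forces_sym[OF assms(1)] forces_sym[OF assms(2)])
next
  fix r :: "(('a \<times> 'b) \<times> ('a \<times> 'b) \<times> 'a \<times> 'b) \<times> nat \<Rightarrow> nat" and x y z
  assume "\<forall>e. x e \<in> pts (eff_prod X Y)" "\<forall>e. y e \<in> pts (eff_prod X Y)"
    "\<forall>e. z e \<in> pts (eff_prod X Y)"
    "forces r (\<lambda>e. eql (eff_prod X Y) (x e) (y e))" "forces r (\<lambda>e. eql (eff_prod X Y) (y e) (z e))"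
  then show "forces r (\<lambda>e. eql (eff_prod X Y) (x e) (z e))"
    using forces_trans[OF assms(1), of "\<lambda>e. fst (x e)" "\<lambda>e. fst (y e)" "\<lambda>e. fst (z e)" r]
      forces_trans[OF assms(2), of "\<lambda>e. snd (x e)" "\<lambda>e. snd (y e)" "\<lambda>e. snd (z e)" r]
    by (simp add: mem_Times_iff)
qed

lemma object_one: "eff_object eff_one"
  by (rule eff_objectI) (auto simp: eff_one_def intro: forces_uniform)

lemma morphism_eff_eq:
  assumes F: "eff_morphism X Y F" and FG: "eff_eq X Y F G"
  shows "eff_morphism X Y G"
proof (rule eff_morphismI)
  note [simp] = forces_eff_eq[OF FG, symmetric]
  show "forces r (\<lambda>e. ext X (x e)) \<and> forces r (\<lambda>e. ext Y (y e))"
    if "\<forall>e. x e \<in> pts X" "\<forall>e. y e \<in> pts Y" "forces r (\<lambda>e. G (x e) (y e))"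
    for r :: "('a \<times> 'b) \<times> nat \<Rightarrow> nat" and x y
    using morphism_strict[OF F that(1,2)] that by simp
  show "forces r (\<lambda>e. G (x' e) (y' e))"
    if "\<forall>e. x e \<in> pts X" "\<forall>e. x' e \<in> pts X" "\<forall>e. y e \<in> pts Y" "\<forall>e. y' e \<in> pts Y"
      "forces r (\<lambda>e. G (x e) (y e))" "forces r (\<lambda>e. eql X (x e) (x' e))"
      "forces r (\<lambda>e. eql Y (y e) (y' e))"
    for r :: "('a \<times> 'a \<times> 'b \<times> 'b) \<times> nat \<Rightarrow> nat" and x x' y y'
    using morphism_rel[OF F that(1-4)] that by simp
  show "forces r (\<lambda>e. eql Y (y e) (y' e))"
    if "\<forall>e. x e \<in> pts X" "\<forall>e. y e \<in> pts Y" "\<forall>e. y' e \<in> pts Y"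
      "forces r (\<lambda>e. G (x e) (y e))" "forces r (\<lambda>e. G (x e) (y' e))"
    for r :: "('a \<times> 'b \<times> 'b) \<times> nat \<Rightarrow> nat" and x y y'
    using morphism_single[OF F that(1-3)] that by simp
  show "\<exists>y. (\<forall>e. y e \<in> pts Y) \<and> forces r (\<lambda>e. G (x e) (y e))"
    if x: "\<forall>e. x e \<in> pts X" "forces r (\<lambda>e. ext X (x e))" for r :: "'a \<times> nat \<Rightarrow> nat" and x
  proof -
    obtain y where "\<forall>e. y e \<in> pts Y" "forces r (\<lambda>e. F (x e) (y e))"
      by (rule morphism_total[OF F x])
    then show ?thesis
      using x by auto
  qed
qed

text \<open>
  Identities, projections and the map to the terminal object are all of this form up to \<^const>\<open>eff_eq\<close>, so
  their functionality is derived from here.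
\<close>

lemma morphism_function:
  fixes X :: "'a eff_obj" and Y :: "'b eff_obj"
  assumes X: "eff_object X" and Y: "eff_object Y" and f: "f ` pts X \<subseteq> pts Y"
    and "valid (\<Inter>x\<in>pts X. \<Inter>x'\<in>pts X. eql X x x' \<^bold>\<longrightarrow> eql Y (f x) (f x'))"
  shows "eff_morphism X Y (\<lambda>x y. ext X x \<^bold>\<and> eql Y (f x) y)"
proof -
  note resp = valid_imp_forces2[OF assms(4)]
  have fp: "\<forall>e. f (x e) \<in> pts Y" if "\<forall>e. x e \<in> pts X" for x :: "_ \<Rightarrow> 'a"
    using f that by blast
  show ?thesis
  proof ((rule eff_morphismI, unfold forces_conj); (elim conjE)?)
    show "forces r (\<lambda>e. ext X (x e)) \<and> forces r (\<lambda>e. ext Y (y e))"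
      if "\<forall>e. x e \<in> pts X" "\<forall>e. y e \<in> pts Y" "forces r (\<lambda>e. ext X (x e))"
        "forces r (\<lambda>e. eql Y (f (x e)) (y e))"
      for r :: "('a \<times> 'b) \<times> nat \<Rightarrow> nat" and x y
      using forces_ext(2)[OF Y fp[OF that(1)] that(2,4)] that(3) by blast
    show "forces r (\<lambda>e. ext X (x' e)) \<and> forces r (\<lambda>e. eql Y (f (x' e)) (y' e))"
      if x: "\<forall>e. x e \<in> pts X" and x': "\<forall>e. x' e \<in> pts X"
        and y: "\<forall>e. y e \<in> pts Y" and y': "\<forall>e. y' e \<in> pts Y"
        and fxy: "forces r (\<lambda>e. eql Y (f (x e)) (y e))"
        and xx': "forces r (\<lambda>e. eql X (x e) (x' e))" and yy': "forces r (\<lambda>e. eql Y (y e) (y' e))"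
      for r :: "('a \<times> 'a \<times> 'b \<times> 'b) \<times> nat \<Rightarrow> nat" and x x' y y'
    proof -
      have "forces r (\<lambda>e. eql Y (f (x' e)) (f (x e)))"
        by (rule resp[OF x' x forces_sym[OF X x x' xx']])
      from forces_trans[OF Y fp[OF x'] fp[OF x] y this fxy]
      have "forces r (\<lambda>e. eql Y (f (x' e)) (y e))" .
      from forces_trans[OF Y fp[OF x'] y y' this yy'] forces_ext(2)[OF X x x' xx'] show ?thesis
        by blast
    qed
    show "forces r (\<lambda>e. eql Y (y e) (y' e))"
      if x: "\<forall>e. x e \<in> pts X" and y: "\<forall>e. y e \<in> pts Y" and y': "\<forall>e. y' e \<in> pts Y"
        and fxy: "forces r (\<lambda>e. eql Y (f (x e)) (y e))" "forces r (\<lambda>e. eql Y (f (x e)) (y' e))"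
      for r :: "('a \<times> 'b \<times> 'b) \<times> nat \<Rightarrow> nat" and x y y'
      using forces_trans[OF Y y fp[OF x] y' forces_sym[OF Y fp[OF x] y fxy(1)] fxy(2)] .
    show "\<exists>y. (\<forall>e. y e \<in> pts Y) \<and> forces r (\<lambda>e. ext X (x e)) \<and> forces r (\<lambda>e. eql Y (f (x e)) (y e))"
      if x: "\<forall>e. x e \<in> pts X" and "forces r (\<lambda>e. ext X (x e))" for r :: "'a \<times> nat \<Rightarrow> nat" and x
      using fp[OF x] resp[OF x x] that(2) by (intro exI[of _ "\<lambda>e. f (x e)"]) (simp add: ext_def)
  qed
qed

lemma morphism_id:
  assumes X: "eff_object X"
  shows "eff_morphism X X (eff_id X)"
proof (rule morphism_eff_eq[OF morphism_function[OF X X, of "\<lambda>x. x"]])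
  show "eff_eq X X (\<lambda>x y. ext X x \<^bold>\<and> eql X x y) (eff_id X)"
    by (rule eff_eqI) (auto simp: eff_id_def intro: forces_ext(1)[OF X])
qed (auto intro: valid_impI2)

lemma morphism_fst:
  assumes X: "eff_object X" and Y: "eff_object Y"
  shows "eff_morphism (eff_prod X Y) X (eff_fst X Y)"
proof (rule morphism_eff_eq[OF morphism_function[OF object_prod[OF X Y] X, of fst]])
  show "eff_eq (eff_prod X Y) X (\<lambda>p x. ext (eff_prod X Y) p \<^bold>\<and> eql X (fst p) x) (eff_fst X Y)"
    by (rule eff_eqI) (auto simp: eff_fst_def mem_Times_iff intro: forces_ext(1)[OF X, rotated 2])
qed (auto intro!: valid_impI2)

lemma morphism_snd:
  assumes X: "eff_object X" and Y: "eff_object Y"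
  shows "eff_morphism (eff_prod X Y) Y (eff_snd X Y)"
proof (rule morphism_eff_eq[OF morphism_function[OF object_prod[OF X Y] Y, of snd]])
  show "eff_eq (eff_prod X Y) Y (\<lambda>p y. ext (eff_prod X Y) p \<^bold>\<and> eql Y (snd p) y) (eff_snd X Y)"
    by (rule eff_eqI) (auto simp: eff_snd_def mem_Times_iff intro: forces_ext(1)[OF Y, rotated 2])
qed (auto intro!: valid_impI2)

lemma morphism_bang:
  assumes X: "eff_object X"
  shows "eff_morphism X eff_one (eff_bang X)"
proof (rule morphism_eff_eq[OF morphism_function[OF X object_one, of "\<lambda>_. ()"]])
  show "eff_eq X eff_one (\<lambda>x y. ext X x \<^bold>\<and> eql eff_one () y) (eff_bang X)"
    by (rule eff_eqI) (auto simp: eff_bang_def eff_one_def intro: forces_uniform)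
qed (auto simp: eff_one_def intro!: valid_impI2 forces_uniform)

lemma morphism_comp:
  fixes X :: "'a eff_obj" and Y :: "'b eff_obj" and Z :: "'c eff_obj"
  assumes F: "eff_morphism X Y F" and G: "eff_morphism Y Z G" 
    and X: "eff_object X" and Y: "eff_object Y" and Z: "eff_object Z"
  shows "eff_morphism X Z (eff_comp Y G F)"
proof (rule eff_morphismI, unfold eff_comp_def forces_UN forces_conj)
  fix r :: "('a \<times> 'c) \<times> nat \<Rightarrow> nat" and x z
  assume "\<forall>e. x e \<in> pts X" "\<forall>e. z e \<in> pts Z"
    "\<exists>y. (\<forall>e. y e \<in> pts Y) \<and> forces r (\<lambda>e. F (x e) (y e)) \<and> forces r (\<lambda>e. G (y e) (z e))"
  then show "forces r (\<lambda>e. ext X (x e)) \<and> forces r (\<lambda>e. ext Z (z e))"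
    by (blast intro: morphism_strict[OF F] morphism_strict[OF G])
next
  fix r :: "('a \<times> 'a \<times> 'c \<times> 'c) \<times> nat \<Rightarrow> nat" and x x' z z'
  assume pts: "\<forall>e. x e \<in> pts X" "\<forall>e. x' e \<in> pts X" "\<forall>e. z e \<in> pts Z" "\<forall>e. z' e \<in> pts Z"
    and "\<exists>y. (\<forall>e. y e \<in> pts Y) \<and> forces r (\<lambda>e. F (x e) (y e)) \<and> forces r (\<lambda>e. G (y e) (z e))"
    and eql: "forces r (\<lambda>e. eql X (x e) (x' e))" "forces r (\<lambda>e. eql Z (z e) (z' e))"
  then obtain y where y: "\<forall>e. y e \<in> pts Y"
    and FG: "forces r (\<lambda>e. F (x e) (y e))" "forces r (\<lambda>e. G (y e) (z e))"
    by blast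
  from morphism_strict(2)[OF F pts(1) y FG(1)] have yy: "forces r (\<lambda>e. eql Y (y e) (y e))"
    by (simp add: ext_def)
  from morphism_rel[OF F pts(1,2) y y FG(1) eql(1) yy] morphism_rel[OF G y y pts(3,4) FG(2) yy eql(2)] y
  show "\<exists>y. (\<forall>e. y e \<in> pts Y) \<and> forces r (\<lambda>e. F (x' e) (y e)) \<and> forces r (\<lambda>e. G (y e) (z' e))"
    by blast
next
  fix r :: "('a \<times> 'c \<times> 'c) \<times> nat \<Rightarrow> nat" and x z z'
  assume pts: "\<forall>e. x e \<in> pts X" "\<forall>e. z e \<in> pts Z" "\<forall>e. z' e \<in> pts Z"
    and "\<exists>y. (\<forall>e. y e \<in> pts Y) \<and> forces r (\<lambda>e. F (x e) (y e)) \<and> forces r (\<lambda>e. G (y e) (z e))"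
    and "\<exists>y. (\<forall>e. y e \<in> pts Y) \<and> forces r (\<lambda>e. F (x e) (y e)) \<and> forces r (\<lambda>e. G (y e) (z' e))"
  then obtain y y' where y: "\<forall>e. y e \<in> pts Y" "\<forall>e. y' e \<in> pts Y"
    and Fy: "forces r (\<lambda>e. F (x e) (y e))" "forces r (\<lambda>e. F (x e) (y' e))"
    and Gy: "forces r (\<lambda>e. G (y e) (z e))" "forces r (\<lambda>e. G (y' e) (z' e))"
    by blast
  from morphism_strict(2)[OF G y(1) pts(2) Gy(1)] have zz: "forces r (\<lambda>e. eql Z (z e) (z e))"
    by (simp add: ext_def)
  have "forces r (\<lambda>e. eql Y (y e) (y' e))"
    by (rule morphism_single[OF F pts(1) y Fy])
  from morphism_rel[OF G y pts(2) pts(2) Gy(1) this zz]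
  show "forces r (\<lambda>e. eql Z (z e) (z' e))"
    by (rule morphism_single[OF G y(2) pts(2,3) _ Gy(2)])
next
  fix r :: "'a \<times> nat \<Rightarrow> nat" and x
  assume x: "\<forall>e. x e \<in> pts X" "forces r (\<lambda>e. ext X (x e))"
  obtain y where y: "\<forall>e. y e \<in> pts Y" and Fy: "forces r (\<lambda>e. F (x e) (y e))"
    by (rule morphism_total[OF F x])
  obtain z where "\<forall>e. z e \<in> pts Z" "forces r (\<lambda>e. G (y e) (z e))"
    by (rule morphism_total[OF G y morphism_strict(2)[OF F x(1) y Fy]])
  with y Fy show "\<exists>z. (\<forall>e. z e \<in> pts Z) \<and> (\<exists>y. (\<forall>e. y e \<in> pts Y) \<and>
      forces r (\<lambda>e. F (x e) (y e)) \<and> forces r (\<lambda>e. G (y e) (z e)))"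
    by blast
qed

lemma morphism_pair:
  fixes A :: "'c eff_obj" and X :: "'a eff_obj" and Y :: "'b eff_obj"
  assumes F: "eff_morphism A X F" and G: "eff_morphism A Y G"
  shows "eff_morphism A (eff_prod X Y) (eff_pair F G)"
proof ((rule eff_morphismI,
    unfold eff_pair_def eql_prod ext_prod forces_conj pts_prod mem_Times_iff all_conj_distrib);
    (elim conjE)?)
  fix r :: "('c \<times> 'a \<times> 'b) \<times> nat \<Rightarrow> nat" and a p
  assume "\<forall>e. a e \<in> pts A" "\<forall>e. fst (p e) \<in> pts X" "\<forall>e. snd (p e) \<in> pts Y"
    "forces r (\<lambda>e. F (a e) (fst (p e)))" "forces r (\<lambda>e. G (a e) (snd (p e)))"
  then show "forces r (\<lambda>e. ext A (a e)) \<and>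
      forces r (\<lambda>e. ext X (fst (p e))) \<and> forces r (\<lambda>e. ext Y (snd (p e)))"
    using morphism_strict[OF F, of a "\<lambda>e. fst (p e)"] morphism_strict[OF G, of a "\<lambda>e. snd (p e)"]
    by blast
next
  fix r :: "('c \<times> 'c \<times> ('a \<times> 'b) \<times> 'a \<times> 'b) \<times> nat \<Rightarrow> nat" and a a' p p'
  assume "\<forall>e. a e \<in> pts A" "\<forall>e. a' e \<in> pts A"
    "\<forall>e. fst (p e) \<in> pts X" "\<forall>e. snd (p e) \<in> pts Y" "\<forall>e. fst (p' e) \<in> pts X" "\<forall>e. snd (p' e) \<in> pts Y"
    "forces r (\<lambda>e. F (a e) (fst (p e)))" "forces r (\<lambda>e. G (a e) (snd (p e)))"
    "forces r (\<lambda>e. eql A (a e) (a' e))"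
    "forces r (\<lambda>e. eql X (fst (p e)) (fst (p' e)))" "forces r (\<lambda>e. eql Y (snd (p e)) (snd (p' e)))"
  then show "forces r (\<lambda>e. F (a' e) (fst (p' e))) \<and> forces r (\<lambda>e. G (a' e) (snd (p' e)))"
    using morphism_rel[OF F, of a a' "\<lambda>e. fst (p e)" "\<lambda>e. fst (p' e)"]
      morphism_rel[OF G, of a a' "\<lambda>e. snd (p e)" "\<lambda>e. snd (p' e)"]
    by blast
next
  fix r :: "('c \<times> ('a \<times> 'b) \<times> 'a \<times> 'b) \<times> nat \<Rightarrow> nat" and a p p'
  assume "\<forall>e. a e \<in> pts A"
    "\<forall>e. fst (p e) \<in> pts X" "\<forall>e. snd (p e) \<in> pts Y" "\<forall>e. fst (p' e) \<in> pts X" "\<forall>e. snd (p' e) \<in> pts Y"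
    "forces r (\<lambda>e. F (a e) (fst (p e)))" "forces r (\<lambda>e. G (a e) (snd (p e)))"
    "forces r (\<lambda>e. F (a e) (fst (p' e)))" "forces r (\<lambda>e. G (a e) (snd (p' e)))"
  then show "forces r (\<lambda>e. eql X (fst (p e)) (fst (p' e))) \<and> forces r (\<lambda>e. eql Y (snd (p e)) (snd (p' e)))"
    using morphism_single[OF F, of a "\<lambda>e. fst (p e)" "\<lambda>e. fst (p' e)"]
      morphism_single[OF G, of a "\<lambda>e. snd (p e)" "\<lambda>e. snd (p' e)"]
    by blast
next
  fix r :: "'c \<times> nat \<Rightarrow> nat" and a
  assume a: "\<forall>e. a e \<in> pts A" "forces r (\<lambda>e. ext A (a e))"
  obtain x where "\<forall>e. x e \<in> pts X" "forces r (\<lambda>e. F (a e) (x e))"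
    by (rule morphism_total[OF F a])
  moreover obtain y where "\<forall>e. y e \<in> pts Y" "forces r (\<lambda>e. G (a e) (y e))"
    by (rule morphism_total[OF G a])
  ultimately show "\<exists>p. ((\<forall>e. fst (p e) \<in> pts X) \<and> (\<forall>e. snd (p e) \<in> pts Y)) \<and>
      forces r (\<lambda>e. F (a e) (fst (p e))) \<and> forces r (\<lambda>e. G (a e) (snd (p e)))"
    by (intro exI[of _ "\<lambda>e. (x e, y e)"]) simp
qed

section \<open>Supports of relations\<close>

text \<open>
  Agreement of relations after forgetting which numbers realize them.
\<close>

definition same_support :: "'a set \<Rightarrow> 'b set \<Rightarrow> ('a, 'b) eff_rel \<Rightarrow> ('a, 'b) eff_rel \<Rightarrow> bool"
  where "same_support A B F G \<longleftrightarrow> (\<forall>a\<in>A. \<forall>b\<in>B. F a b = {} \<longleftrightarrow> G a b = {})"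

definition same_points :: "'a eff_obj \<Rightarrow> 'a eff_obj \<Rightarrow> bool" where
  "same_points X X' \<longleftrightarrow> pts X = pts X' \<and> same_support (pts X') (pts X') (eql X) (eql X')"

lemma rconj_empty [simp]: "(P \<^bold>\<and> Q) = {} \<longleftrightarrow> P = {} \<or> Q = {}"
  by (auto simp: rconj_def)

lemma same_support_refl: "same_support A B F F"
  by (simp add: same_support_def)

lemma same_support_trans:
  "same_support A B F G \<Longrightarrow> same_support A B G H \<Longrightarrow> same_support A B F H"
  by (simp add: same_support_def)

lemma same_support_sym: "same_support A B F G \<Longrightarrow> same_support A B G F"
  by (simp add: same_support_def)

lemma same_support_comp:
  "same_support A (pts Y') F F' \<Longrightarrow> same_support (pts Y') C G G' \<Longrightarrow> pts Y = pts Y' \<Longrightarrow>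
    same_support A C (eff_comp Y G F) (eff_comp Y' G' F')"
  by (auto simp: same_support_def eff_comp_def)

lemma same_support_pair:
  "same_support A B F F' \<Longrightarrow> same_support A C G G' \<Longrightarrow>
    same_support A (B \<times> C) (eff_pair F G) (eff_pair F' G')"
  by (auto simp: same_support_def eff_pair_def)

lemma same_points_refl: "same_points X X"
  by (simp add: same_points_def same_support_refl)

lemma same_points_prod:
  "same_points X X' \<Longrightarrow> same_points Y Y' \<Longrightarrow> same_points (eff_prod X Y) (eff_prod X' Y')"
  by (auto simp: same_points_def same_support_def)

lemma same_support_id: "same_points X X' \<Longrightarrow> same_support (pts X') (pts X') (eff_id X) (eff_id X')"
  by (simp add: same_points_def eff_id_def)

lemma same_support_bang: "same_points X X' \<Longrightarrow> same_support (pts X') B (eff_bang X) (eff_bang X')"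
  by (simp add: same_points_def same_support_def eff_bang_def ext_def)

lemma pts_prod3 [simp]: "pts (eff_prod3 X Y Z) = pts X \<times> pts Y \<times> pts Z"
  by (simp add: eff_prod3_def)

lemma same_support_fst:
  "same_points X X' \<Longrightarrow> same_points Y Y' \<Longrightarrow>
    same_support (pts (eff_prod X' Y')) (pts X') (eff_fst X Y) (eff_fst X' Y')"
  by (auto simp: same_points_def same_support_def eff_fst_def ext_def)

lemma same_support_snd:
  "same_points X X' \<Longrightarrow> same_points Y Y' \<Longrightarrow>
    same_support (pts (eff_prod X' Y')) (pts Y') (eff_snd X Y) (eff_snd X' Y')"
  by (auto simp: same_points_def same_support_def eff_snd_def ext_def)

lemma same_support_proj1:
  "same_points X X' \<Longrightarrow> same_points Y Y' \<Longrightarrow> same_points Z Z' \<Longrightarrow>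
    same_support (pts (eff_prod3 X' Y' Z')) (pts X') (proj1 X Y Z) (proj1 X' Y' Z')"
  using same_support_fst[OF _ same_points_prod] by (simp add: proj1_def)

lemma same_support_proj2:
  "same_points X X' \<Longrightarrow> same_points Y Y' \<Longrightarrow> same_points Z Z' \<Longrightarrow>
    same_support (pts (eff_prod3 X' Y' Z')) (pts Y') (proj2 X Y Z) (proj2 X' Y' Z')"
  unfolding proj2_def
  using same_support_snd[OF _ same_points_prod, of X X' Y Y' Z Z'] same_support_fst[of Y Y' Z Z']
  by (intro same_support_comp) (auto simp: same_points_def)

lemma same_support_proj3:
  "same_points X X' \<Longrightarrow> same_points Y Y' \<Longrightarrow> same_points Z Z' \<Longrightarrow>
    same_support (pts (eff_prod3 X' Y' Z')) (pts Z') (proj3 X Y Z) (proj3 X' Y' Z')"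
  unfolding proj3_def
  using same_support_snd[OF _ same_points_prod, of X X' Y Y' Z Z'] same_support_snd[of Y Y' Z Z']
  by (intro same_support_comp) (auto simp: same_points_def)

lemma same_support_eff_eq: "eff_eq X Y F G \<Longrightarrow> same_support (pts X) (pts Y) F G"
  unfolding same_support_def
  using forces_eff_eq[of X Y F G "\<lambda>_ :: unit. _" "\<lambda>_. _" "\<lambda>_. 0"] by auto

section \<open>Double negation sheafification\<close>

text \<open>
  In classical terms this is the constant object on the set of points of \<open>X\<close> up to realized equality: by
  \<open>rneg_rneg\<close>, its equality has all realizers or none. Points of \<open>X\<close> without a realizer stay
  without one.
\<close>

definition sheafify :: "'a eff_obj \<Rightarrow> 'a eff_obj"
  where "sheafify X = \<lparr>pts = pts X, eql = (\<lambda>x y. \<^bold>\<not> \<^bold>\<not> eql X x y)\<rparr>"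

text \<open>
  Every structure morphism of the sheafified module, and also the unit, arises from a morphism \<open>F\<close> of
  the original data in this way. The factor \<open>ext A x\<close> is there for strictness, as \<open>A\<close> may have a factor,
  such as the ring of scalars, whose realizers cannot be recovered from \<open>\<^bold>\<not> \<^bold>\<not> F x y\<close>.
\<close>

definition lift :: "'a eff_obj \<Rightarrow> ('a, 'b) eff_rel \<Rightarrow> ('a, 'b) eff_rel"
  where "lift A F x y = (ext A x \<^bold>\<and> \<^bold>\<not> \<^bold>\<not> F x y)"

lemma pts_sheafify [simp]: "pts (sheafify X) = pts X"
  and eql_sheafify [simp]: "eql (sheafify X) x y = (\<^bold>\<not> \<^bold>\<not> eql X x y)"
  and ext_sheafify [simp]: "ext (sheafify X) x = (\<^bold>\<not> \<^bold>\<not> ext X x)"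
  by (simp_all add: sheafify_def ext_def)

lemma rneg_rneg_empty [simp]: "(\<^bold>\<not> \<^bold>\<not> P) = {} \<longleftrightarrow> P = {}"
  by (simp add: rneg_rneg)

lemma same_points_sheafify: "same_points (sheafify X) X"
  by (simp add: same_points_def same_support_def)

lemma object_support:
  assumes "eff_object X"
  shows "x \<in> pts X \<Longrightarrow> y \<in> pts X \<Longrightarrow> eql X x y \<noteq> {} \<Longrightarrow> eql X y x \<noteq> {}"
    and "x \<in> pts X \<Longrightarrow> y \<in> pts X \<Longrightarrow> z \<in> pts X \<Longrightarrow> eql X x y \<noteq> {} \<Longrightarrow> eql X y z \<noteq> {} \<Longrightarrow> eql X x z \<noteq> {}"
  using forces_sym[OF assms, of "\<lambda>_ :: unit. x" "\<lambda>_. y" "\<lambda>_. 0"]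
    forces_trans[OF assms, of "\<lambda>_ :: unit. x" "\<lambda>_. y" "\<lambda>_. z" "\<lambda>_. 0"]
  by simp_all

lemma morphism_support:
  assumes "eff_morphism X Y F"
  shows "x \<in> pts X \<Longrightarrow> y \<in> pts Y \<Longrightarrow> F x y \<noteq> {} \<Longrightarrow> ext X x \<noteq> {}"
    and "x \<in> pts X \<Longrightarrow> y \<in> pts Y \<Longrightarrow> F x y \<noteq> {} \<Longrightarrow> ext Y y \<noteq> {}"
    and "x \<in> pts X \<Longrightarrow> x' \<in> pts X \<Longrightarrow> y \<in> pts Y \<Longrightarrow> y' \<in> pts Y \<Longrightarrow> F x y \<noteq> {} \<Longrightarrow>
      eql X x x' \<noteq> {} \<Longrightarrow> eql Y y y' \<noteq> {} \<Longrightarrow> F x' y' \<noteq> {}"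
    and "x \<in> pts X \<Longrightarrow> y \<in> pts Y \<Longrightarrow> y' \<in> pts Y \<Longrightarrow> F x y \<noteq> {} \<Longrightarrow> F x y' \<noteq> {} \<Longrightarrow> eql Y y y' \<noteq> {}"
    and "x \<in> pts X \<Longrightarrow> ext X x \<noteq> {} \<Longrightarrow> \<exists>y\<in>pts Y. F x y \<noteq> {}"
  using morphism_strict[OF assms, of "\<lambda>_ :: unit. x" "\<lambda>_. y" "\<lambda>_. 0"]
    morphism_rel[OF assms, of "\<lambda>_ :: unit. x" "\<lambda>_. x'" "\<lambda>_. y" "\<lambda>_. y'" "\<lambda>_. 0"]
    morphism_single[OF assms, of "\<lambda>_ :: unit. x" "\<lambda>_. y" "\<lambda>_. y'" "\<lambda>_. 0"]
    apply simp_all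
  by (rule morphism_total[OF assms, of "\<lambda>_ :: unit. x" "\<lambda>_. 0"]) (auto dest: forces_inhabited)

text \<open>
  This computes composites with the unit of the sheafification, which has the same support as the
  identity \<open>eql X\<close>. The reason is that \<open>G\<close> respects equality.
\<close>

lemma same_support_eql_comp:
  assumes G: "eff_morphism A X G"
  shows "same_support (pts A) (pts X) (eff_comp X (eql X) G) G"
proof -
  note supp = morphism_support[OF G]
  have "(\<exists>y\<in>pts X. G a y \<noteq> {} \<and> eql X y x \<noteq> {}) \<longleftrightarrow> G a x \<noteq> {}" if "a \<in> pts A" "x \<in> pts X" for a x
  proof
    assume "\<exists>y\<in>pts X. G a y \<noteq> {} \<and> eql X y x \<noteq> {}"
    then show "G a x \<noteq> {}"
      using that supp(1)[of a] supp(3)[of a a _ x] unfolding ext_def by blast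
  next
    assume "G a x \<noteq> {}"
    then show "\<exists>y\<in>pts X. G a y \<noteq> {} \<and> eql X y x \<noteq> {}"
      using that supp(2)[of a x] unfolding ext_def by blast
  qed
  then show ?thesis
    unfolding same_support_def eff_comp_def by (simp; blast)
qed

lemma object_sheafify:
  assumes "eff_object X"
  shows "eff_object (sheafify X)"
  by (rule eff_objectI, unfold eql_sheafify forces_notnot pts_sheafify)
    (metis object_support[OF assms])+

lemma same_support_lift:
  assumes "eff_morphism X Y F" and "same_points A X"
  shows "same_support (pts X) (pts Y) (lift A F) F"
  using assms morphism_support(1)[OF assms(1)]
  by (auto simp: same_support_def same_points_def lift_def ext_def)

text \<open>
  Since the equality of the target is a double negation, single-valuedness and totality need to be
  checked on supports only. The domain may be changed to an object with more generous realizers, for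
  example from \<open>X \<times> X\<close> to the square of the sheafification.
\<close>

lemma morphism_lift:
  fixes X :: "'a eff_obj" and Y :: "'b eff_obj"
  assumes F: "eff_morphism X Y F" and A: "eff_object A" and AX: "same_points A X"
  shows "eff_morphism A (sheafify Y) (lift A F)"
proof -
  note supp = morphism_support[OF F]
  from AX have pts: "pts A = pts X"
    and eql: "\<And>x x'. x \<in> pts X \<Longrightarrow> x' \<in> pts X \<Longrightarrow> eql A x x' = {} \<longleftrightarrow> eql X x x' = {}"
    by (auto simp: same_points_def same_support_def)
  show ?thesis
  proof (rule eff_morphismI, unfold lift_def forces_conj forces_notnot eql_sheafify ext_sheafify pts pts_sheafify)
    fix r :: "('a \<times> 'b) \<times> nat \<Rightarrow> nat" and x y
    assume "\<forall>e. x e \<in> pts X" "\<forall>e. y e \<in> pts Y" "forces r (\<lambda>e. ext A (x e)) \<and> (\<forall>e. F (x e) (y e) \<noteq> {})"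
    then show "forces r (\<lambda>e. ext A (x e)) \<and> (\<forall>e. ext Y (y e) \<noteq> {})"
      using supp(2) by blast
  next
    fix r :: "('a \<times> 'a \<times> 'b \<times> 'b) \<times> nat \<Rightarrow> nat" and x x' y y'
    assume x: "\<forall>e. x e \<in> pts X" "\<forall>e. x' e \<in> pts X" and y: "\<forall>e. y e \<in> pts Y" "\<forall>e. y' e \<in> pts Y"
      and Fxy: "forces r (\<lambda>e. ext A (x e)) \<and> (\<forall>e. F (x e) (y e) \<noteq> {})"
      and xx': "forces r (\<lambda>e. eql A (x e) (x' e))" and yy': "\<forall>e. eql Y (y e) (y' e) \<noteq> {}"
    have "forces r (\<lambda>e. ext A (x' e))"
      by (rule forces_ext(2)[OF A _ _ xx']) (simp_all add: pts x)
    moreover have "F (x' e) (y' e) \<noteq> {}" for e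
      using supp(3)[of "x e" "x' e" "y e" "y' e"] x y Fxy yy' forces_inhabited[OF xx', of e] eql
      by blast
    ultimately show "forces r (\<lambda>e. ext A (x' e)) \<and> (\<forall>e. F (x' e) (y' e) \<noteq> {})"
      by blast
  next
    fix r :: "('a \<times> 'b \<times> 'b) \<times> nat \<Rightarrow> nat" and x y y'
    assume "\<forall>e. x e \<in> pts X" "\<forall>e. y e \<in> pts Y" "\<forall>e. y' e \<in> pts Y"
      "forces r (\<lambda>e. ext A (x e)) \<and> (\<forall>e. F (x e) (y e) \<noteq> {})"
      "forces r (\<lambda>e. ext A (x e)) \<and> (\<forall>e. F (x e) (y' e) \<noteq> {})"
    then show "\<forall>e. eql Y (y e) (y' e) \<noteq> {}"
      using supp(4) by blast
  next
    fix r :: "'a \<times> nat \<Rightarrow> nat" and x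
    assume x: "\<forall>e. x e \<in> pts X" and ext: "forces r (\<lambda>e. ext A (x e))"
    have "\<exists>y. y \<in> pts Y \<and> F (x e) y \<noteq> {}" for e
      using supp(5)[of "x e"] x eql[of "x e" "x e"] forces_inhabited[OF ext, of e] by (auto simp: ext_def)
    then obtain y where "\<forall>e. y e \<in> pts Y \<and> F (x e) (y e) \<noteq> {}"
      by metis
    with ext show "\<exists>y. (\<forall>e. y e \<in> pts Y) \<and> forces r (\<lambda>e. ext A (x e)) \<and> (\<forall>e. F (x e) (y e) \<noteq> {})"
      by blast
  qed
qed

text \<open>
  Given a realizer of \<open>F a y\<close>, strictness of \<open>F\<close> and totality of \<open>G\<close> yield a realizer of \<open>G a y'\<close> for some
  \<open>y'\<close>. As the supports agree, \<open>G a y\<close> is also inhabited, so \<open>y\<close> and \<open>y'\<close> are equal in the sheafification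
  at no cost, and the realizer of \<open>G a y'\<close> can be transported to \<open>G a y\<close>.
\<close>

lemma eff_eq_sheafifyI:
  fixes A :: "'a eff_obj" and Y :: "'b eff_obj"
  assumes F: "eff_morphism A (sheafify Y) F" and G: "eff_morphism A (sheafify Y) G"
    and FG: "same_support (pts A) (pts Y) F G"
  shows "eff_eq A (sheafify Y) F G"
proof -
  have *: "forces r (\<lambda>e. G (a e) (y e))"
    if F: "eff_morphism A (sheafify Y) F" and G: "eff_morphism A (sheafify Y) G"
      and FG: "same_support (pts A) (pts Y) F G"
      and a: "\<forall>e. a e \<in> pts A" and y: "\<forall>e. y e \<in> pts (sheafify Y)" and Fay: "forces r (\<lambda>e. F (a e) (y e))"
    for F G and r :: "('a \<times> 'b) \<times> nat \<Rightarrow> nat" and a y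
  proof -
    have ext: "forces r (\<lambda>e. ext A (a e))"
      by (rule morphism_strict(1)[OF F a y Fay])
    obtain y' where y': "\<forall>e. y' e \<in> pts (sheafify Y)" and Gay': "forces r (\<lambda>e. G (a e) (y' e))"
      by (rule morphism_total[OF G a ext])
    have "G (a e) (y e) \<noteq> {}" for e
      using forces_inhabited[OF Fay, of e] FG a y by (simp add: same_support_def)
    then have "eql (sheafify Y) (y' e) (y e) \<noteq> {}" for e
      using morphism_support(4)[OF G, of "a e" "y' e" "y e"] a y y' forces_inhabited[OF Gay', of e]
      by blast
    then have "forces r (\<lambda>e. eql (sheafify Y) (y' e) (y e))"
      by simp
    with ext show ?thesis
      unfolding ext_def by (rule morphism_rel[OF G a a y' y Gay'])
  qed
  show ?thesis
    by (rule eff_eqI) (blast intro: *[OF F G FG] *[OF G F same_support_sym[OF FG]])+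
qed

text \<open>
  The form in which axioms are carried over: the primed relations are the two sides of an axiom for
  the sheafified module and the others those of the axiom for the original module.
\<close>

lemma eff_eq_transfer:
  assumes "eff_eq A Y F G" and "pts A' = pts A"
    and "eff_morphism A' (sheafify Y) F'" and "eff_morphism A' (sheafify Y) G'"
    and "same_support (pts A) (pts Y) F' F" and "same_support (pts A) (pts Y) G' G"
  shows "eff_eq A' (sheafify Y) F' G'"
  using assms same_support_eff_eq[OF assms(1)]
  by (intro eff_eq_sheafifyI) (auto simp: same_support_def)

section \<open>Flabbiness and monomorphisms\<close>

text \<open>
  The number of a code that always returns \<open>b\<close>. Such numbers realize all the implications whose conclusion
  has a realizer known in advance.
\<close>

definition konst :: "nat \<Rightarrow> nat"
  where "konst b = gnum (SOME c. \<forall>n. eval c n b)"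

lemma konst_imp: "(P \<noteq> {} \<Longrightarrow> b \<in> Q) \<Longrightarrow> konst b \<in> (P \<^bold>\<longrightarrow> Q)"
proof -
  have "\<exists>c. \<forall>n. eval c n b"
    using computable_const[of b] by (simp add: computable_def)
  then have "\<forall>n. eval (SOME c. \<forall>n. eval c n b) n b"
    by (rule someI_ex)
  then show "(P \<noteq> {} \<Longrightarrow> b \<in> Q) \<Longrightarrow> konst b \<in> (P \<^bold>\<longrightarrow> Q)"
    unfolding konst_def rimp_def kapp_def by blast
qed

lemma rimp_inhabited: "(P \<^bold>\<longrightarrow> Q) \<noteq> {} \<Longrightarrow> P \<noteq> {} \<Longrightarrow> Q \<noteq> {}"
  unfolding rimp_def by blast

lemma INT_rimp_inhabited: "(\<Inter>x\<in>A. P x \<^bold>\<longrightarrow> Q x) \<noteq> {} \<Longrightarrow> x \<in> A \<Longrightarrow> P x \<noteq> {} \<Longrightarrow> Q x \<noteq> {}"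
  unfolding rimp_def by blast

text \<open>
  The realizer is a constant: which point contains the given subsingleton \<open>K\<close> is decided by excluded
  middle, and it is never computed. The point \<open>z\<close> serves the case in which \<open>K\<close> is empty.
\<close>

lemma flabby_sheafify:
  assumes "z \<in> pts X" and "ext X z \<noteq> {}"
  shows "flabby (sheafify X)"
proof -
  let ?Y = "sheafify X"
  let ?b = "konst (konst 0)"
  have "konst (konst \<langle>0, ?b\<rangle>) \<in> int_all (eff_power ?Y) (\<lambda>K.
      int_all ?Y (\<lambda>x. int_all ?Y (\<lambda>y. int_mem ?Y x K \<^bold>\<longrightarrow> int_mem ?Y y K \<^bold>\<longrightarrow> eql ?Y x y)) \<^bold>\<longrightarrow>
      int_ex ?Y (\<lambda>x. int_all ?Y (\<lambda>y. int_mem ?Y y K \<^bold>\<longrightarrow> eql ?Y y x)))"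
    unfolding int_all_def[of "eff_power ?Y"]
  proof (intro INT_I konst_imp)
    fix K
    assume K: "ext (eff_power ?Y) K \<noteq> {}"
      and sub: "int_all ?Y (\<lambda>x. int_all ?Y (\<lambda>y. int_mem ?Y x K \<^bold>\<longrightarrow> int_mem ?Y y K \<^bold>\<longrightarrow> eql ?Y x y)) \<noteq> {}"
    have ext: "ext X x \<noteq> {}" if "x \<in> pts X" "K x \<noteq> {}" for x
    proof -
      from K have "(\<Inter>x\<in>pts X. K x \<^bold>\<longrightarrow> ext ?Y x) \<noteq> {}"
        unfolding ext_def[of "eff_power _"] by (simp add: eff_power_def)
      then have "ext ?Y x \<noteq> {}"
        using that by (rule INT_rimp_inhabited)
      then show ?thesis
        by simp
    qed
    have eql: "eql X x y \<noteq> {}" if "x \<in> pts X" "y \<in> pts X" "K x \<noteq> {}" "K y \<noteq> {}" for x y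
    proof -
      have mem: "int_mem ?Y x K \<noteq> {}" "int_mem ?Y y K \<noteq> {}"
        using that K by (simp_all add: int_mem_def)
      moreover have "ext ?Y x \<noteq> {}" "ext ?Y y \<noteq> {}"
        using that ext by simp_all
      moreover note INT_rimp_inhabited[OF sub[unfolded int_all_def[of ?Y]], of x]
      ultimately have "(\<Inter>y\<in>pts ?Y. ext ?Y y \<^bold>\<longrightarrow> int_mem ?Y x K \<^bold>\<longrightarrow> int_mem ?Y y K \<^bold>\<longrightarrow> eql ?Y x y) \<noteq> {}"
        using that(1) by simp
      from INT_rimp_inhabited[OF this, of y]
      have "(int_mem ?Y x K \<^bold>\<longrightarrow> int_mem ?Y y K \<^bold>\<longrightarrow> eql ?Y x y) \<noteq> {}"
        using that(2) \<open>ext ?Y y \<noteq> {}\<close> by simp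
      then have "eql ?Y x y \<noteq> {}"
        using mem rimp_inhabited by blast
      then show ?thesis
        by simp
    qed
    obtain x where x: "x \<in> pts X" "ext X x \<noteq> {}" and xK: "\<And>y. y \<in> pts X \<Longrightarrow> K y \<noteq> {} \<Longrightarrow> eql X y x \<noteq> {}"
    proof (cases "\<exists>x\<in>pts X. K x \<noteq> {}")
      case True
      with eql ext that show thesis by blast
    next
      case False
      with assms that show thesis by blast
    qed
    have "?b \<in> int_all ?Y (\<lambda>y. int_mem ?Y y K \<^bold>\<longrightarrow> eql ?Y y x)"
      unfolding int_all_def
      by (intro INT_I konst_imp) (use xK in \<open>auto simp: int_mem_def rneg_rneg\<close>)
    moreover have "0 \<in> ext ?Y x"
      using x by (simp add: rneg_rneg)
    ultimately show "\<langle>0, ?b\<rangle> \<in> int_ex ?Y (\<lambda>x. int_all ?Y (\<lambda>y. int_mem ?Y y K \<^bold>\<longrightarrow> eql ?Y y x))"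
      using x unfolding int_ex_def rconj_def by auto
  qed
  then show ?thesis
    unfolding flabby_def valid_def by blast
qed

text \<open>
  The converse of \<open>eff_mono_injective\<close>. If \<open>x\<close> is the value of \<open>G\<close> with image \<open>z\<close>, then equality of the
  composites yields a value \<open>x'\<close> of \<open>H\<close> with the same image, and injectivity identifies it with \<open>x\<close>.
\<close>

lemma eff_monoI:
  fixes X :: "'a eff_obj" and Y :: "'b eff_obj"
  assumes X: "eff_object X" and F: "eff_morphism X Y F"
    and inj: "valid (\<Inter>x\<in>pts X. \<Inter>x'\<in>pts X. \<Inter>z\<in>pts Y. (F x z \<^bold>\<and> F x' z) \<^bold>\<longrightarrow> eql X x' x)"
  shows "eff_mono X Y F"
  unfolding eff_mono_def
proof (intro conjI allI impI)
  fix A :: "('a \<times> 'a) eff_obj" and G H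
  assume A: "eff_object A" and G: "eff_morphism A X G" and H: "eff_morphism A X H"
    and eq: "eff_eq A Y (eff_comp X F G) (eff_comp X F H)"
  have *: "forces r (\<lambda>e. H (a e) (x e))"
    if G: "eff_morphism A X G" and H: "eff_morphism A X H"
      and eq: "\<And>(r :: (('a \<times> 'a) \<times> 'a) \<times> nat \<Rightarrow> nat) a z. \<forall>e. a e \<in> pts A \<Longrightarrow> \<forall>e. z e \<in> pts Y \<Longrightarrow>
        forces r (\<lambda>e. eff_comp X F G (a e) (z e)) \<Longrightarrow> forces r (\<lambda>e. eff_comp X F H (a e) (z e))"
      and a: "\<forall>e. a e \<in> pts A" and x: "\<forall>e. x e \<in> pts X" and Gax: "forces r (\<lambda>e. G (a e) (x e))"
    for G H and r :: "(('a \<times> 'a) \<times> 'a) \<times> nat \<Rightarrow> nat" and a x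
  proof -
    obtain z where z: "\<forall>e. z e \<in> pts Y" and Fxz: "forces r (\<lambda>e. F (x e) (z e))"
      by (rule morphism_total[OF F x morphism_strict(2)[OF G a x Gax]])
    have "forces r (\<lambda>e. eff_comp X F G (a e) (z e))"
      unfolding eff_comp_def forces_UN using x Gax Fxz by auto
    from eq[OF a z this] obtain x' where x': "\<forall>e. x' e \<in> pts X"
      and Hax': "forces r (\<lambda>e. H (a e) (x' e))" and Fx'z: "forces r (\<lambda>e. F (x' e) (z e))"
      unfolding eff_comp_def forces_UN by auto
    have "forces r (\<lambda>e. eql X (x' e) (x e))"
      by (rule valid_imp_forces3[OF inj x x' z]) (simp add: Fxz Fx'z)
    with morphism_strict(1)[OF H a x' Hax'] show ?thesis
      unfolding ext_def by (rule morphism_rel[OF H a a x' x Hax'])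
  qed
  show "eff_eq A X G H"
    by (rule eff_eqI) (rule *[OF G H] *[OF H G]; simp add: forces_eff_eq[OF eq])+
qed (rule F)

text \<open>
  The internal statement has two nested universal quantifiers, each of which is an implication from
  the existence of the point; \<open>forces_mp\<close> is used once for each of them and once for the double negation.
\<close>

lemma forces_separated:
  assumes "notnot_separated X" and x: "\<forall>e. x e \<in> pts X" and y: "\<forall>e. y e \<in> pts X"
    and ext: "forces r (\<lambda>e. ext X (x e))" "forces r (\<lambda>e. ext X (y e))" and "\<forall>e. eql X (x e) (y e) \<noteq> {}"
  shows "forces r (\<lambda>e. eql X (x e) (y e))"
proof -
  let ?sep = "\<lambda>x y. (\<^bold>\<not> \<^bold>\<not> eql X x y) \<^bold>\<longrightarrow> eql X x y"
  from assms(1) obtain n where n: "n \<in> int_all X (\<lambda>x. int_all X (?sep x))"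
    unfolding notnot_separated_def valid_def by blast
  have "forces r (\<lambda>e. ext X (x e) \<^bold>\<longrightarrow> int_all X (?sep (x e)))"
    by (rule forces_uniform[of n]) (use n x in \<open>simp add: int_all_def\<close>)
  then have "forces r (\<lambda>e. int_all X (?sep (x e)))"
    using ext(1) by (rule forces_mp)
  then obtain c where "\<forall>e. runs c (r e) (int_all X (?sep (x e)))"
    unfolding forces_def by blast
  then have "forces r (\<lambda>e. ext X (y e) \<^bold>\<longrightarrow> ?sep (x e) (y e))"
    unfolding forces_def runs_def int_all_def using y by (intro exI[of _ c]) blast
  then have "forces r (\<lambda>e. ?sep (x e) (y e))"
    using ext(2) by (rule forces_mp)
  then show ?thesis
    by (rule forces_mp) (simp add: assms(6))
qed

text \<open>
  A realizer of the graph of the unit at \<open>(x, z)\<close> contains a realizer of the existence of \<open>x\<close>, which is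
  what separatedness asks for.
\<close>

lemma mono_lift_eql:
  fixes X :: "'a eff_obj"
  assumes X: "eff_object X" and "notnot_separated X"
  shows "eff_mono X (sheafify X) (lift X (eql X))"
proof (rule eff_monoI[OF X morphism_lift[OF morphism_id[OF X, unfolded eff_id_def] X same_points_refl]])
  note supp = object_support[OF X]
  show "valid (\<Inter>x\<in>pts X. \<Inter>x'\<in>pts X. \<Inter>z\<in>pts (sheafify X).
      (lift X (eql X) x z \<^bold>\<and> lift X (eql X) x' z) \<^bold>\<longrightarrow> eql X x' x)"
  proof (rule valid_impI3, unfold lift_def forces_conj forces_notnot pts_sheafify, elim conjE)
    fix r :: "('a \<times> 'a \<times> 'a) \<times> nat \<Rightarrow> nat" and x x' z
    assume pts: "\<forall>e. x e \<in> pts X" "\<forall>e. x' e \<in> pts X" "\<forall>e. z e \<in> pts X"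
      and ext: "forces r (\<lambda>e. ext X (x e))" "forces r (\<lambda>e. ext X (x' e))"
      and "\<forall>e. eql X (x e) (z e) \<noteq> {}" "\<forall>e. eql X (x' e) (z e) \<noteq> {}"
    then have "\<forall>e. eql X (x' e) (x e) \<noteq> {}"
      by (metis supp)
    then show "forces r (\<lambda>e. eql X (x' e) (x e))"
      by (rule forces_separated[OF assms(2) pts(2,1) ext(2,1)])
  qed
qed

section \<open>The sheafified module\<close>

lemma morphism_proj1:
  "eff_object X \<Longrightarrow> eff_object Y \<Longrightarrow> eff_object Z \<Longrightarrow> eff_morphism (eff_prod3 X Y Z) X (proj1 X Y Z)"
  unfolding eff_prod3_def proj1_def by (intro morphism_fst object_prod)

lemma morphism_proj2:
  "eff_object X \<Longrightarrow> eff_object Y \<Longrightarrow> eff_object Z \<Longrightarrow> eff_morphism (eff_prod3 X Y Z) Y (proj2 X Y Z)"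
  unfolding eff_prod3_def proj2_def
  by (intro morphism_comp[OF morphism_snd morphism_fst] object_prod)

lemma morphism_proj3:
  "eff_object X \<Longrightarrow> eff_object Y \<Longrightarrow> eff_object Z \<Longrightarrow> eff_morphism (eff_prod3 X Y Z) Z (proj3 X Y Z)"
  unfolding eff_prod3_def proj3_def
  by (intro morphism_comp[OF morphism_snd morphism_snd] object_prod)

lemma object_prod3:
  "eff_object X \<Longrightarrow> eff_object Y \<Longrightarrow> eff_object Z \<Longrightarrow> eff_object (eff_prod3 X Y Z)"
  unfolding eff_prod3_def by (intro object_prod)

definition sheafify_module :: "('r, 'y) eff_ring_scheme \<Rightarrow> ('r, 'm) eff_module \<Rightarrow> ('r, 'm) eff_module" where
  "sheafify_module R M = (let Y = sheafify (obj M) in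
     \<lparr>obj = Y, add = lift (eff_prod Y Y) (add M), zero = lift eff_one (zero M), neg = lift Y (neg M),
      smul = lift (eff_prod (obj R) Y) (smul M)\<rparr>)"

context
  fixes R :: "('r, 'y) eff_ring_scheme" and M :: "('r, 'm) eff_module"
  assumes ring: "ring_object R" and module: "module_object R M"
begin

private abbreviation (input) "S \<equiv> obj R"
private abbreviation (input) "X \<equiv> obj M"
private abbreviation (input) "Y \<equiv> sheafify X"
private abbreviation (input) "N \<equiv> sheafify_module R M"

lemma sheafify_module_simps:
  "obj N = Y" "add N = lift (eff_prod Y Y) (add M)" "zero N = lift eff_one (zero M)"
  "neg N = lift Y (neg M)" "smul N = lift (eff_prod S Y) (smul M)"
  by (simp_all add: sheafify_module_def Let_def)

lemma object_R: "eff_object S"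
  using ring by (simp add: ring_object_def ab_group_object_def Let_def)

lemma object_M: "eff_object X"
  using module by (simp add: module_object_def ab_group_object_def Let_def)

lemma object_N: "eff_object Y"
  using object_M by (rule object_sheafify)

lemma operations_R:
  "eff_morphism (eff_prod S S) S (add R)" "eff_morphism (eff_prod S S) S (mul R)"
  "eff_morphism eff_one S (one R)"
  using ring by (simp_all add: ring_object_def ab_group_object_def Let_def)

lemma operations_M:
  "eff_morphism (eff_prod X X) X (add M)" "eff_morphism eff_one X (zero M)"
  "eff_morphism X X (neg M)" "eff_morphism (eff_prod S X) X (smul M)"
  using module by (simp_all add: module_object_def ab_group_object_def Let_def)

lemmas same_points = same_points_prod same_points_refl same_points_sheafify

lemmas objects = object_R object_M object_N object_prod object_prod3 object_one

lemma operations_N: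
  "eff_morphism (eff_prod Y Y) Y (add N)" "eff_morphism eff_one Y (zero N)"
  "eff_morphism Y Y (neg N)" "eff_morphism (eff_prod S Y) Y (smul N)"
  unfolding sheafify_module_simps by (rule morphism_lift[OF operations_M(1)] morphism_lift[OF operations_M(2)]
    morphism_lift[OF operations_M(3)] morphism_lift[OF operations_M(4)]; intro objects same_points)+

lemma morphisms_at:
  assumes "eff_object A"
  shows "eff_morphism A S (r :: ('c, 'r) eff_rel) \<Longrightarrow> eff_morphism A S s \<Longrightarrow> eff_morphism A S (plus_at R r s)"
    and "eff_morphism A S r \<Longrightarrow> eff_morphism A S s \<Longrightarrow> eff_morphism A S (mul_at R r s)"
    and "eff_morphism A S (one_at R A)"
    and "eff_morphism A Y x \<Longrightarrow> eff_morphism A Y y \<Longrightarrow> eff_morphism A Y (plus_at N x y)"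
    and "eff_morphism A Y (zero_at N A)"
    and "eff_morphism A S r \<Longrightarrow> eff_morphism A Y x \<Longrightarrow> eff_morphism A Y (smul_at R N r x)"
    and "eff_morphism A X x' \<Longrightarrow> eff_morphism A X y' \<Longrightarrow> eff_morphism A X (plus_at M x' y')"
    and "eff_morphism A S r \<Longrightarrow> eff_morphism A X x' \<Longrightarrow> eff_morphism A X (smul_at R M r x')"
  unfolding plus_at_def mul_at_def one_at_def zero_at_def smul_at_def sheafify_module_simps(1)
  by (rule morphism_comp morphism_pair morphism_bang operations_R operations_M operations_N objects assms;
      assumption?)+

lemma supports_N:
  "same_support (pts X \<times> pts X) (pts X) (add N) (add M)" "same_support (pts eff_one) (pts X) (zero N) (zero M)"
  "same_support (pts X) (pts X) (neg N) (neg M)" "same_support (pts S \<times> pts X) (pts X) (smul N) (smul M)"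
proof -
  note lift = operations_M[THEN same_support_lift]
  show "same_support (pts X \<times> pts X) (pts X) (add N) (add M)"
    using lift(1)[OF same_points_prod[OF same_points_sheafify same_points_sheafify]]
    by (simp add: sheafify_module_simps)
  show "same_support (pts eff_one) (pts X) (zero N) (zero M)"
    using lift(2)[OF same_points_refl] by (simp add: sheafify_module_simps)
  show "same_support (pts X) (pts X) (neg N) (neg M)"
    using lift(3)[OF same_points_sheafify] by (simp add: sheafify_module_simps)
  show "same_support (pts S \<times> pts X) (pts X) (smul N) (smul M)"
    using lift(4)[OF same_points_prod[OF same_points_refl same_points_sheafify]]
    by (simp add: sheafify_module_simps)
qed

lemma supports_at:
  shows "same_support A (pts S) r r' \<Longrightarrow> same_support A (pts S) s s' \<Longrightarrow>
      same_support A (pts S) (plus_at R r s) (plus_at R r' s')"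
    and "same_support A (pts S) r r' \<Longrightarrow> same_support A (pts S) s s' \<Longrightarrow>
      same_support A (pts S) (mul_at R r s) (mul_at R r' s')"
    and "same_points B B' \<Longrightarrow> same_support (pts B') (pts S) (one_at R B) (one_at R B')"
    and "same_support A (pts X) x x' \<Longrightarrow> same_support A (pts X) y y' \<Longrightarrow>
      same_support A (pts X) (plus_at N x y) (plus_at M x' y')"
    and "same_points B B' \<Longrightarrow> same_support (pts B') (pts X) (zero_at N B) (zero_at M B')"
    and "same_support A (pts S) r r' \<Longrightarrow> same_support A (pts X) x x' \<Longrightarrow>
      same_support A (pts X) (smul_at R N r x) (smul_at R M r' x')"
  unfolding plus_at_def mul_at_def one_at_def zero_at_def smul_at_def
  by (intro same_support_comp; simp add: sheafify_module_simps(1) same_support_refl same_support_pair same_support_bang supports_N)+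

text \<open>
  The terms on both sides of an axiom are built from projections and operations; each of these is a
  morphism and keeps its support when \<open>M\<close> is replaced by \<open>N\<close>, so that \<open>eff_eq_transfer\<close> applies.
\<close>

lemma module_sheafify_module: "module_object R N"
proof -
  note morphs = morphisms_at morphism_proj1 morphism_proj2 morphism_proj3 morphism_fst morphism_snd
    morphism_id objects operations_N
  note supports = supports_at same_support_id same_support_fst same_support_snd
    same_support_proj1 same_support_proj2 same_support_proj3 supports_N same_points
  have "ab_group_object N"
    unfolding ab_group_object_def Let_def sheafify_module_simps(1)
  proof (intro conjI)
    let ?x = "proj1 X X X" and ?y = "proj2 X X X" and ?z = "proj3 X X X"
    have "eff_eq (eff_prod3 X X X) X (plus_at M (plus_at M ?x ?y) ?z) (plus_at M ?x (plus_at M ?y ?z))"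
      using module by (simp add: module_object_def ab_group_object_def Let_def)
    then show "eff_eq (eff_prod3 Y Y Y) Y
        (plus_at N (plus_at N (proj1 Y Y Y) (proj2 Y Y Y)) (proj3 Y Y Y))
        (plus_at N (proj1 Y Y Y) (plus_at N (proj2 Y Y Y) (proj3 Y Y Y)))"
      by (rule eff_eq_transfer) (simp, intro morphs, intro morphs, intro supports, intro supports)
  next
    have "eff_eq (eff_prod X X) X (plus_at M (eff_fst X X) (eff_snd X X))
        (plus_at M (eff_snd X X) (eff_fst X X))"
      using module by (simp add: module_object_def ab_group_object_def Let_def)
    then show "eff_eq (eff_prod Y Y) Y (plus_at N (eff_fst Y Y) (eff_snd Y Y))
        (plus_at N (eff_snd Y Y) (eff_fst Y Y))"
      by (rule eff_eq_transfer) (simp, intro morphs, intro morphs, intro supports, intro supports)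
  next
    have "eff_eq X X (plus_at M (zero_at M X) (eff_id X)) (eff_id X)"
      using module by (simp add: module_object_def ab_group_object_def Let_def)
    then show "eff_eq Y Y (plus_at N (zero_at N Y) (eff_id Y)) (eff_id Y)"
      by (rule eff_eq_transfer) (simp, intro morphs, intro morphs, intro supports, intro supports)
  next
    have "eff_eq X X (plus_at M (neg M) (eff_id X)) (zero_at M X)"
      using module by (simp add: module_object_def ab_group_object_def Let_def)
    then show "eff_eq Y Y (plus_at N (neg N) (eff_id Y)) (zero_at N Y)"
      by (rule eff_eq_transfer) (simp, intro morphs, intro morphs, intro supports, intro supports)
  qed (intro morphs)+
  then show ?thesis
    unfolding module_object_def Let_def sheafify_module_simps(1)
  proof (intro conjI)
    let ?r = "proj1 S S X" and ?s = "proj2 S S X" and ?x = "proj3 S S X"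
    let ?r' = "proj1 S S Y" and ?s' = "proj2 S S Y" and ?x' = "proj3 S S Y"
    have "eff_eq (eff_prod3 S S X) X (smul_at R M (mul_at R ?r ?s) ?x) (smul_at R M ?r (smul_at R M ?s ?x))"
      using module by (simp add: module_object_def Let_def)
    then show "eff_eq (eff_prod3 S S Y) Y (smul_at R N (mul_at R ?r' ?s') ?x')
        (smul_at R N ?r' (smul_at R N ?s' ?x'))"
      by (rule eff_eq_transfer) (simp, intro morphs, intro morphs, intro supports, intro supports)
    have "eff_eq (eff_prod3 S S X) X (smul_at R M (plus_at R ?r ?s) ?x)
        (plus_at M (smul_at R M ?r ?x) (smul_at R M ?s ?x))"
      using module by (simp add: module_object_def Let_def)
    then show "eff_eq (eff_prod3 S S Y) Y (smul_at R N (plus_at R ?r' ?s') ?x')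
        (plus_at N (smul_at R N ?r' ?x') (smul_at R N ?s' ?x'))"
      by (rule eff_eq_transfer) (simp, intro morphs, intro morphs, intro supports, intro supports)
  next
    let ?r = "proj1 S X X" and ?x = "proj2 S X X" and ?y = "proj3 S X X"
    let ?r' = "proj1 S Y Y" and ?x' = "proj2 S Y Y" and ?y' = "proj3 S Y Y"
    have "eff_eq (eff_prod3 S X X) X (smul_at R M ?r (plus_at M ?x ?y))
        (plus_at M (smul_at R M ?r ?x) (smul_at R M ?r ?y))"
      using module by (simp add: module_object_def Let_def)
    then show "eff_eq (eff_prod3 S Y Y) Y (smul_at R N ?r' (plus_at N ?x' ?y'))
        (plus_at N (smul_at R N ?r' ?x') (smul_at R N ?r' ?y'))"
      by (rule eff_eq_transfer) (simp, intro morphs, intro morphs, intro supports, intro supports)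
  next
    have "eff_eq X X (smul_at R M (one_at R X) (eff_id X)) (eff_id X)"
      using module by (simp add: module_object_def Let_def)
    then show "eff_eq Y Y (smul_at R N (one_at R Y) (eff_id Y)) (eff_id Y)"
      by (rule eff_eq_transfer) (simp, intro morphs, intro morphs, intro supports, intro supports)
  qed (assumption | intro morphs)+
qed

lemma unit_morphism: "eff_morphism X Y (lift X (eql X))"
  using morphism_lift[OF morphism_id[OF object_M] object_M same_points_refl] by (simp add: eff_id_def)

lemma unit_support:
  assumes "eff_morphism A X g"
  shows "same_support (pts A) (pts X) (eff_comp X (lift X (eql X)) g) g"
proof (rule same_support_trans[OF same_support_comp same_support_eql_comp[OF assms]])
  show "same_support (pts X) (pts X) (lift X (eql X)) (eql X)"
    using same_support_lift[OF morphism_id[OF object_M] same_points_refl] by (simp add: eff_id_def)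
qed (simp_all add: same_support_refl)

text \<open>
  Up to support, composing with the unit does nothing and the operations of \<open>N\<close> are those of \<open>M\<close>; so both
  sides of a linearity condition have the support of the operation of \<open>M\<close>.
\<close>

lemma linear_unit: "linear_morphism R M N (lift X (eql X))"
proof -
  let ?i = "eff_comp X (lift X (eql X))"
  have morph: "eff_morphism A Y (?i g)" if "eff_object A" "eff_morphism A X g" for A :: "'c eff_obj" and g
    by (rule morphism_comp[OF that(2) unit_morphism that(1) object_M object_N])
  show ?thesis
    unfolding linear_morphism_def Let_def sheafify_module_simps(1)
  proof (intro conjI)
    let ?x = "eff_fst X X" and ?y = "eff_snd X X"
    have P: "eff_object (eff_prod X X)" and x: "eff_morphism (eff_prod X X) X ?x"
      and y: "eff_morphism (eff_prod X X) X ?y"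
      by (intro object_prod morphism_fst morphism_snd object_M)+
    show "eff_eq (eff_prod X X) Y (?i (plus_at M ?x ?y)) (plus_at N (?i ?x) (?i ?y))"
    proof (rule eff_eq_sheafifyI)
      have xy: "eff_morphism (eff_prod X X) X (plus_at M ?x ?y)"
        by (rule morphisms_at[OF P]) (rule x y)+
      then show "eff_morphism (eff_prod X X) Y (?i (plus_at M ?x ?y))"
        by (rule morph[OF P])
      show "eff_morphism (eff_prod X X) Y (plus_at N (?i ?x) (?i ?y))"
        by (rule morphisms_at[OF P]) (rule morph[OF P] x y)+
      show "same_support (pts (eff_prod X X)) (pts X) (?i (plus_at M ?x ?y)) (plus_at N (?i ?x) (?i ?y))"
        using unit_support[OF xy] supports_at(4)[OF unit_support[OF x] unit_support[OF y]]
        by (blast intro: same_support_trans same_support_sym)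
    qed
  next
    let ?r = "eff_fst S X" and ?x = "eff_snd S X"
    have P: "eff_object (eff_prod S X)" and r: "eff_morphism (eff_prod S X) S ?r"
      and x: "eff_morphism (eff_prod S X) X ?x"
      by (intro object_prod morphism_fst morphism_snd object_R object_M)+
    show "eff_eq (eff_prod S X) Y (?i (smul_at R M ?r ?x)) (smul_at R N ?r (?i ?x))"
    proof (rule eff_eq_sheafifyI)
      have rx: "eff_morphism (eff_prod S X) X (smul_at R M ?r ?x)"
        by (rule morphisms_at[OF P]) (rule r x)+
      then show "eff_morphism (eff_prod S X) Y (?i (smul_at R M ?r ?x))"
        by (rule morph[OF P])
      show "eff_morphism (eff_prod S X) Y (smul_at R N ?r (?i ?x))"
        by (rule morphisms_at[OF P]) (rule morph[OF P] r x)+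
      show "same_support (pts (eff_prod S X)) (pts X) (?i (smul_at R M ?r ?x)) (smul_at R N ?r (?i ?x))"
        using unit_support[OF rx] supports_at(6)[OF same_support_refl unit_support[OF x]]
        by (blast intro: same_support_trans same_support_sym)
    qed
  qed (rule unit_morphism)
qed

text \<open>
  The point that serves empty subsingletons is the zero of \<open>M\<close>.
\<close>

lemma flabby_sheafify_module: "flabby (obj N)"
proof -
  obtain z where "z \<in> pts X" "zero M () z \<noteq> {}"
    using morphism_support(5)[OF operations_M(2), of "()"] by (auto simp: eff_one_def ext_def)
  moreover from this have "ext X z \<noteq> {}"
    using morphism_support(2)[OF operations_M(2), of "()"] by (simp add: eff_one_def)
  ultimately show ?thesis
    unfolding sheafify_module_simps(1) by (intro flabby_sheafify)
qed

end

theorem proposition5p2: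
  fixes R :: "'r eff_ring" and M :: "('r, 'm) eff_module"
  assumes "ring_object R"
    and "module_object R M"
    and "notnot_separated (obj M)"
  shows "\<exists>(N :: ('r, 'm) eff_module) F.
           module_object R N \<and> flabby (obj N) \<and>
           linear_morphism R M N F \<and> eff_mono (obj M) (obj N) F"
proof (intro exI conjI)
  show "module_object R (sheafify_module R M)"
    by (rule module_sheafify_module[OF assms(1,2)])
  show "flabby (obj (sheafify_module R M))"
    by (rule flabby_sheafify_module[OF assms(1,2)])
  show "linear_morphism R M (sheafify_module R M) (lift (obj M) (eql (obj M)))"
    by (rule linear_unit[OF assms(1,2)])
  show "eff_mono (obj M) (obj (sheafify_module R M)) (lift (obj M) (eql (obj M)))"
    unfolding sheafify_module_simps(1)[OF assms(1,2)] by (rule mono_lift_eql[OF object_M[OF assms(1,2)] assms(3)])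
qed

end
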